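(* Let $X$ be a (connected) non-positively curved cell complex and let $f : X \to S^1$ be a circle-valued Morse function which induces an epimorphism of fundamental groups $f_\ast : G = \pi_1(X) \to \mathbb{Z} = \pi_1(S^1)$. Let $K = \ker f_\ast$. Let $\sigma$ be a finite-order isometry of $X$ such that (i) $\sigma$ fixes a vertex $v \in X$; (ii) $\sigma$ acts without fixed points on the link $Lk(v,X)$; (iii) $f$ is $\sigma$-equivariant for the trivial action of $\sigma$ on $S^1$, that is, $f \circ \sigma = f$. Denote also by $\sigma$ the automorphism of $G$ (based at $v$) induced by the isometry $\sigma$; it leaves $K$ invariant. Form the semidirect product $G \rtimes \langle \sigma \rangle$, which contains $K \rtimes \langle \sigma \rangle$ as a subgroup. Then the group $K \rtimes \langle \sigma \rangle$ has infinitely many conjugacy classes of elements with the same order as $\sigma$. In fact, the conjugacy class of $\sigma$ in $G \rtimes \langle \sigma \rangle$ intersects $K \rtimes \langle \sigma \rangle$ to give infinitely many $K \rtimes \langle \sigma \rangle$-conjugacy classes.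
   Context: Here $\langle\sigma\rangle$ is the finite cyclic group generated by the isometry $\sigma$, acting on $G$ through the induced automorphism. The map $f_\ast$ extends to $G \rtimes \langle\sigma\rangle$ by sending $\sigma$ to $0$; the kernel of the extension is $K \rtimes \langle\sigma\rangle$, and $G \rtimes \langle\sigma\rangle = (K \rtimes \langle\sigma\rangle) \rtimes \mathbb{Z}$. Cell complexes: $X$ is an affine cell complex, i.e. a complex built from convex polyhedral cells, each cell having a characteristic map whose restriction to each face is, up to an affine homeomorphism, the characteristic map of another cell. It is non-positively curved, in the usual sense, if it carries a metric that is locally CAT(0), so that the universal cover $\widetilde X$ with the induced metric is a CAT(0) space. The link $Lk(v,X)$ is the space of directions at $v$ (germs of geodesic segments issuing from $v$); an isometry fixing $v$ acts on it. Morse functions: a map $\tilde f : Y \to \mathbb{R}$ on an affine cell complex $Y$ is a Morse function if its composition with the characteristic map of each cell extends to an affine map to $\mathbb{R}$, it is non-constant on every cell of positive dimension, and the image of the $0$-skeleton is discrete in $\mathbb{R}$. A circle-valued Morse function on $X$ is a map $f : X \to S^1 = \mathbb{R}/\mathbb{Z}$ which lifts to a Morse function $\tilde f : \widetilde X \to \mathbb{R}$ on the universal cover. *)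

theory Defs
  imports
    "HOL-Analysis.Analysis"
    "HOL-Algebra.Bij"
    "HOL-Algebra.Generated_Groups"
    "HOL-Algebra.Multiplicative_Group"
begin

section \<open>Affine cell complexes\<close>

definition affine_map :: "('v::real_vector \<Rightarrow> 'w::real_vector) \<Rightarrow> bool" where
  "affine_map h \<longleftrightarrow> (\<exists>A c. linear A \<and> (\<forall>x. h x = A x + c))"

text \<open>
  A cell structure is a set of pairs \<open>(P, \<kappa>)\<close>: a convex polyhedral cell \<open>P\<close> together with its
  characteristic map \<open>\<kappa>\<close>.  The ambient type \<open>'v\<close> of the polytopes may be infinite-dimensional,
  so that no bound on the dimension of the complex is imposed.  The last clause relates the cells
  to the topology of \<open>X\<close>: all subcomplexes are closed.  It holds for the weak (CW) topology and
  also for the usual metric topology of polyhedral complexes that are not locally finite.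
\<close>
definition affine_cell_complex ::
    "'a::topological_space set \<Rightarrow> ('v::real_normed_vector set \<times> ('v \<Rightarrow> 'a)) set \<Rightarrow> bool" where
  "affine_cell_complex X \<C> \<longleftrightarrow>
     (\<forall>(P, \<kappa>)\<in>\<C>. polytope P \<and> P \<noteq> {} \<and> continuous_on P \<kappa> \<and> \<kappa> ` P \<subseteq> X
                  \<and> inj_on \<kappa> (rel_interior P)) \<and>
     (\<Union>(P, \<kappa>)\<in>\<C>. \<kappa> ` rel_interior P) = X \<and>
     (\<forall>(P, \<kappa>)\<in>\<C>. \<forall>(Q, \<psi>)\<in>\<C>. (P, \<kappa>) \<noteq> (Q, \<psi>) \<longrightarrow>
         \<kappa> ` rel_interior P \<inter> \<psi> ` rel_interior Q = {}) \<and>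
     (\<forall>(P, \<kappa>)\<in>\<C>. \<forall>F. F face_of P \<and> F \<noteq> {} \<longrightarrow>
         (\<exists>(Q, \<psi>)\<in>\<C>. \<exists>h k. affine_map h \<and> homeomorphism F Q h k
                          \<and> (\<forall>x\<in>F. \<kappa> x = \<psi> (h x)))) \<and>
     (\<forall>\<D>\<subseteq>\<C>. closedin (top_of_set X) (\<Union>(P, \<kappa>)\<in>\<D>. \<kappa> ` P))"

definition zero_skeleton :: "('v set \<times> ('v \<Rightarrow> 'a)) set \<Rightarrow> 'a set" where
  "zero_skeleton \<C> = {\<kappa> a | \<kappa> a. ({a}, \<kappa>) \<in> \<C>}"

section \<open>CAT(0) spaces and non-positive curvature\<close>

definition geodesic_segment ::
    "'a::metric_space set \<Rightarrow> 'a \<Rightarrow> 'a \<Rightarrow> (real \<Rightarrow> 'a) \<Rightarrow> bool" where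
  "geodesic_segment S x y \<gamma> \<longleftrightarrow>
     \<gamma> 0 = x \<and> \<gamma> 1 = y \<and> \<gamma> ` {0..1} \<subseteq> S \<and>
     (\<forall>s\<in>{0..1}. \<forall>t\<in>{0..1}. dist (\<gamma> s) (\<gamma> t) = \<bar>s - t\<bar> * dist x y)"

text \<open>
  \<open>a', b', c'\<close> is a Euclidean comparison triangle for the geodesic triangle with vertices
  \<open>a, b, c\<close>.  Any two distinct sides of a triangle share a vertex, so it suffices to compare
  points on the two sides issuing from \<open>a\<close>.
\<close>
definition CAT0 :: "'a::metric_space set \<Rightarrow> bool" where
  "CAT0 S \<longleftrightarrow>
     (\<forall>x\<in>S. \<forall>y\<in>S. \<exists>\<gamma>. geodesic_segment S x y \<gamma>) \<and>
     (\<forall>a\<in>S. \<forall>b\<in>S. \<forall>c\<in>S. \<forall>\<beta> \<gamma>. geodesic_segment S a b \<beta> \<and> geodesic_segment S a c \<gamma> \<longrightarrow>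
       (\<forall>a' b' c' :: real^2. dist a' b' = dist a b \<and> dist a' c' = dist a c \<and> dist b' c' = dist b c \<longrightarrow>
         (\<forall>s\<in>{0..1}. \<forall>t\<in>{0..1}.
            dist (\<beta> s) (\<gamma> t) \<le> dist (linepath a' b' s) (linepath a' c' t))))"

definition locally_CAT0 :: "'a::metric_space set \<Rightarrow> bool" where
  "locally_CAT0 X \<longleftrightarrow> (\<forall>x\<in>X. \<exists>r>0. CAT0 (X \<inter> ball x r))"

definition curve_length :: "(real \<Rightarrow> 'a::metric_space) \<Rightarrow> ennreal" where
  "curve_length \<gamma> =
     (SUP (n, t) \<in> {(n :: nat, t :: nat \<Rightarrow> real). mono t \<and> range t \<subseteq> {0..1}}.
        \<Sum>i<n. ennreal (dist (\<gamma> (t i)) (\<gamma> (t (Suc i)))))"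

definition universal_cover ::
    "'b::topological_space set \<Rightarrow> ('b \<Rightarrow> 'a::topological_space) \<Rightarrow> 'a set \<Rightarrow> bool" where
  "universal_cover Y p X \<longleftrightarrow> covering_space Y p X \<and> simply_connected Y"

text \<open>The distance on \<open>Y\<close> is the length metric induced by \<open>p\<close>.\<close>
definition induced_metric ::
    "'b::metric_space set \<Rightarrow> ('b \<Rightarrow> 'a::metric_space) \<Rightarrow> bool" where
  "induced_metric Y p \<longleftrightarrow>
     (\<forall>x\<in>Y. \<forall>y\<in>Y. ennreal (dist x y) =
        (INF \<gamma> \<in> {\<gamma>. path \<gamma> \<and> path_image \<gamma> \<subseteq> Y \<and> pathstart \<gamma> = x \<and> pathfinish \<gamma> = y}.
           curve_length (p \<circ> \<gamma>)))"

text \<open>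
  The universal cover \<open>p : Y \<rightarrow> X\<close> is an argument.  That \<open>Y\<close> is CAT(0) is part of the notion;
  for complete \<open>X\<close> it follows from local CAT(0)-ness by the Cartan-Hadamard theorem, but not
  for arbitrary locally CAT(0) metrics.
\<close>
definition nonpositively_curved ::
    "'a::metric_space set \<Rightarrow> 'b::metric_space set \<Rightarrow> ('b \<Rightarrow> 'a) \<Rightarrow> bool" where
  "nonpositively_curved X Y p \<longleftrightarrow> locally_CAT0 X \<and> induced_metric Y p \<and> CAT0 Y"

section \<open>Morse functions\<close>

definition morse_function ::
    "'a::topological_space set \<Rightarrow> ('v::real_vector set \<times> ('v \<Rightarrow> 'a)) set \<Rightarrow> ('a \<Rightarrow> real) \<Rightarrow> bool" where
  "morse_function Y \<C> F \<longleftrightarrow>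
     continuous_on Y F \<and>
     (\<forall>(P, \<kappa>)\<in>\<C>. (\<exists>h. affine_map h \<and> (\<forall>x\<in>P. F (\<kappa> x) = h x)) \<and>
                  ((\<nexists>a. P = {a}) \<longrightarrow> \<not> (F \<circ> \<kappa>) constant_on P)) \<and>
     discrete (F ` zero_skeleton \<C>)"

text \<open>The cell structure on a covering space: all lifts of the characteristic maps.\<close>
definition lifted_cells ::
    "'b::topological_space set \<Rightarrow> ('b \<Rightarrow> 'a) \<Rightarrow> ('v::topological_space set \<times> ('v \<Rightarrow> 'a)) set
      \<Rightarrow> ('v set \<times> ('v \<Rightarrow> 'b)) set" where
  "lifted_cells Y p \<C> =
     {(P, \<psi>). \<exists>\<kappa>. (P, \<kappa>) \<in> \<C> \<and> \<psi> \<in> extensional P \<and> continuous_on P \<psi> \<and> \<psi> ` P \<subseteq> Y \<and>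
                  (\<forall>x\<in>P. p (\<psi> x) = \<kappa> x)}"

text \<open>The circle \<open>\<real>/\<int>\<close> is the unit circle in \<open>\<complex>\<close>, via \<open>t \<mapsto> cis (2 \<pi> t)\<close>.\<close>
abbreviation circle :: "complex set" where
  "circle \<equiv> sphere 0 1"

definition circle_valued_morse_function ::
    "'a::topological_space set \<Rightarrow> ('v::real_normed_vector set \<times> ('v \<Rightarrow> 'a)) set
      \<Rightarrow> 'b::topological_space set \<Rightarrow> ('b \<Rightarrow> 'a) \<Rightarrow> ('a \<Rightarrow> complex) \<Rightarrow> bool" where
  "circle_valued_morse_function X \<C> Y p f \<longleftrightarrow>
     continuous_on X f \<and> f ` X \<subseteq> circle \<and>
     (\<exists>F. (\<forall>y\<in>Y. f (p y) = cis (2 * pi * F y)) \<and> morse_function Y (lifted_cells Y p \<C>) F)"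

section \<open>Links\<close>

text \<open>
  Geodesic segments issuing from \<open>v\<close>, parametrised by arc length on some interval \<open>[0, a]\<close>;
  their values elsewhere are irrelevant.
\<close>
definition geodesics_from :: "'a::metric_space set \<Rightarrow> 'a \<Rightarrow> (real \<Rightarrow> 'a) set" where
  "geodesics_from X v =
     {\<gamma>. \<gamma> 0 = v \<and> (\<exists>a>0. \<gamma> ` {0..a} \<subseteq> X \<and>
            (\<forall>s\<in>{0..a}. \<forall>t\<in>{0..a}. dist (\<gamma> s) (\<gamma> t) = \<bar>s - t\<bar>))}"

definition germ_rel :: "'a::metric_space set \<Rightarrow> 'a \<Rightarrow> ((real \<Rightarrow> 'a) \<times> (real \<Rightarrow> 'a)) set" where
  "germ_rel X v = {(\<gamma>, \<delta>). \<gamma> \<in> geodesics_from X v \<and> \<delta> \<in> geodesics_from X v \<and>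
                           (\<exists>e>0. \<forall>t\<in>{0..e}. \<gamma> t = \<delta> t)}"

definition link :: "'a::metric_space set \<Rightarrow> 'a \<Rightarrow> (real \<Rightarrow> 'a) set set" where
  "link X v = geodesics_from X v // germ_rel X v"

definition link_map ::
    "'a::metric_space set \<Rightarrow> 'a \<Rightarrow> ('a \<Rightarrow> 'a) \<Rightarrow> (real \<Rightarrow> 'a) set \<Rightarrow> (real \<Rightarrow> 'a) set" where
  "link_map X v g \<xi> = germ_rel X v `` ((\<lambda>\<gamma>. g \<circ> \<gamma>) ` \<xi>)"

section \<open>Groups\<close>

definition path_class ::
    "'a::topological_space set \<Rightarrow> (real \<Rightarrow> 'a) \<Rightarrow> (real \<Rightarrow> 'a) set" where
  "path_class X \<gamma> = {\<delta>. homotopic_paths X \<gamma> \<delta>}"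

definition fundamental_group ::
    "'a::topological_space set \<Rightarrow> 'a \<Rightarrow> (real \<Rightarrow> 'a) set monoid" where
  "fundamental_group X v =
     \<lparr> carrier = path_class X `
         {\<gamma>. path \<gamma> \<and> path_image \<gamma> \<subseteq> X \<and> pathstart \<gamma> = v \<and> pathfinish \<gamma> = v},
       monoid.mult = (\<lambda>a b. \<Union>\<gamma>\<in>a. \<Union>\<delta>\<in>b. path_class X (\<gamma> +++ \<delta>)),
       one = path_class X (\<lambda>_. v) \<rparr>"

text \<open>The map of fundamental groups induced by a map \<open>h\<close> into \<open>Z\<close>.\<close>
definition induced_map ::
    "'b::topological_space set \<Rightarrow> ('a \<Rightarrow> 'b) \<Rightarrow> (real \<Rightarrow> 'a) set \<Rightarrow> (real \<Rightarrow> 'b) set" where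
  "induced_map Z h a = (\<Union>\<gamma>\<in>a. path_class Z (h \<circ> \<gamma>))"

definition isometry_group :: "'a::metric_space set \<Rightarrow> ('a \<Rightarrow> 'a) monoid" where
  "isometry_group X =
     (BijGroup X) \<lparr> carrier := {g \<in> Bij X. \<forall>x\<in>X. \<forall>y\<in>X. dist (g x) (g y) = dist x y} \<rparr>"

definition cyclic_subgroup :: "('g, 'm) monoid_scheme \<Rightarrow> 'g \<Rightarrow> ('g, 'm) monoid_scheme" where
  "cyclic_subgroup G g = G \<lparr> carrier := generate G {g} \<rparr>"

definition semidirect_product ::
    "('g, 'm) monoid_scheme \<Rightarrow> ('h, 'n) monoid_scheme \<Rightarrow> ('h \<Rightarrow> 'g \<Rightarrow> 'g) \<Rightarrow> ('g \<times> 'h) monoid" where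
  "semidirect_product G H \<phi> =
     \<lparr> carrier = carrier G \<times> carrier H,
       monoid.mult = (\<lambda>(g, h) (g', h'). (g \<otimes>\<^bsub>G\<^esub> \<phi> h g', h \<otimes>\<^bsub>H\<^esub> h')),
       one = (\<one>\<^bsub>G\<^esub>, \<one>\<^bsub>H\<^esub>) \<rparr>"

definition conjugacy_class :: "('g, 'm) monoid_scheme \<Rightarrow> 'g \<Rightarrow> 'g set" where
  "conjugacy_class G x = {g \<otimes>\<^bsub>G\<^esub> x \<otimes>\<^bsub>G\<^esub> inv\<^bsub>G\<^esub> g | g. g \<in> carrier G}"

end

theory Submission
  imports Defs
begin

text \<open>
  The conjugates \<open>x \<sigma> x\<inverse>\<close> with \<open>x \<in> G\<close> lie in \<open>K \<rtimes> \<langle>\<sigma>\<rangle>\<close> because \<open>f \<circ> \<sigma> = f\<close>.  If two of them, for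
  \<open>x\<close> and \<open>y\<close>, are conjugate by \<open>(k, \<tau>) \<in> K \<rtimes> \<langle>\<sigma>\<rangle>\<close>, then \<open>y\<inverse> k \<tau>(x) \<in> G\<close> is fixed by \<open>\<sigma>\<close>.  Once
  \<open>\<sigma>\<close> has no non-trivial fixed element in \<open>G\<close>, this forces \<open>f\<^sub>*(x) = f\<^sub>*(y)\<close>, so there are at
  least as many classes as elements of \<open>\<pi>\<^sub>1(S\<^sup>1)\<close>.

  For the fixed elements, lift \<open>\<sigma>\<close> to the map \<open>L\<close> of the universal cover that fixes a point \<open>a\<close>
  over \<open>v\<close>.  If \<open>\<sigma>\<close> fixes the class of a loop, then \<open>L\<close> fixes the end point \<open>w\<close> of the lift of the
  loop at \<open>a\<close>.  As \<open>L\<close> does not increase distances, it fixes the unique geodesic from \<open>a\<close> to \<open>w\<close>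
  pointwise.  If \<open>w \<noteq> a\<close>, the image of this geodesic in \<open>X\<close> is a direction at \<open>v\<close> fixed by \<open>\<sigma>\<close>,
  which is excluded; so \<open>w = a\<close> and the loop is null-homotopic.
\<close>

section \<open>Covering spaces and homotopies in metric spaces\<close>

text \<open>
  The Kuratowski embedding reduces lifting and homotopy statements for metric spaces to those for
  subsets of normed vector spaces.
\<close>

lemma kuratowski_embedding:
  "\<exists>e :: 'a::metric_space \<Rightarrow> ('a \<Rightarrow>\<^sub>C real). \<forall>x y. dist (e x) (e y) = dist x y"
proof -
  define k where "k x y = dist x y - dist undefined y" for x y :: 'a
  have k: "k x \<in> bcontfun" for x
  proof (rule bcontfun_normI)
    show "continuous_on UNIV (k x)"
      unfolding k_def by (intro continuous_intros)
    show "norm (k x y) \<le> dist x undefined" for y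
      using dist_triangle2[of x y undefined] dist_triangle2[of undefined y x]
      by (simp add: k_def dist_commute abs_le_iff)
  qed
  have "dist (Bcontfun (k x)) (Bcontfun (k y)) = dist x y" for x y
  proof (rule antisym)
    show "dist (Bcontfun (k x)) (Bcontfun (k y)) \<le> dist x y"
    proof (rule dist_bound)
      fix z
      show "dist (apply_bcontfun (Bcontfun (k x)) z) (apply_bcontfun (Bcontfun (k y)) z) \<le> dist x y"
        using dist_triangle2[of x z y] dist_triangle2[of y z x]
        by (simp add: Bcontfun_inverse[OF k] k_def dist_real_def dist_commute abs_le_iff)
    qed
    \<comment> \<open>The supremum is attained: at the point \<open>y\<close> the two functions
      differ by exactly \<open>dist x y\<close>.\<close>
    show "dist x y \<le> dist (Bcontfun (k x)) (Bcontfun (k y))"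
      using dist_bounded[of "Bcontfun (k x)" y "Bcontfun (k y)"]
      by (simp add: Bcontfun_inverse[OF k] k_def dist_real_def)
  qed
  then show ?thesis by (intro exI[of _ "\<lambda>x. Bcontfun (k x)"]) simp
qed

lemma dist_preserving_imp_homeomorphism:
  fixes e :: "'a::metric_space \<Rightarrow> 'b::metric_space"
  assumes e: "\<And>x y. dist (e x) (e y) = dist x y"
  shows "homeomorphism S (e ` S) e (inv_into UNIV e)"
proof -
  have inj: "inj e"
    by (rule injI) (metis e dist_eq_0_iff)
  show ?thesis
  proof (rule homeomorphismI)
    show "continuous_on S e" "continuous_on (e ` S) (inv_into UNIV e)"
      by (auto simp: continuous_on_iff e inv_f_f[OF inj])
  qed (auto simp: inv_f_f[OF inj])
qed

text \<open>\<open>i\<close> carries evenly covered sets to evenly covered sets, the new sheets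
  being the images of the old ones under \<open>e\<close>. With Kuratowski embeddings for
  \<open>e\<close> and \<open>i\<close>, this places a covering of metric spaces inside normed
  spaces.\<close>

lemma covering_space_homeomorphic_image:
  assumes cov: "covering_space Y p X"
    and hY: "homeomorphism Y Y' e e'" and hX: "homeomorphism X X' i i'"
  shows "covering_space Y' (i \<circ> p \<circ> e') X'"
proof
  have pY: "p ` Y = X" and cp: "continuous_on Y p"
    using cov by (auto simp: covering_space_def)
  show "continuous_on Y' (i \<circ> p \<circ> e')"
    using hY hX cp pY unfolding homeomorphism_def
    by (intro continuous_on_compose) auto
  show "(i \<circ> p \<circ> e') ` Y' = X'"
    using hY hX pY unfolding homeomorphism_def by (metis image_comp)
  fix x' assume x': "x' \<in> X'"
  then have "i' x' \<in> X"
    using hX by (auto simp: homeomorphism_def)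
  then obtain T V where T: "i' x' \<in> T" "openin (top_of_set X) T" and V: "\<Union>V = Y \<inter> p -` T"
    "\<And>u. u \<in> V \<Longrightarrow> openin (top_of_set Y) u" "pairwise disjnt V"
    "\<And>u. u \<in> V \<Longrightarrow> \<exists>q. homeomorphism u T p q"
    using cov unfolding covering_space_def by metis
  have TX: "T \<subseteq> X" using T(2) openin_imp_subset by blast
  have VY: "u \<subseteq> Y" if "u \<in> V" for u using V(2)[OF that] openin_imp_subset by blast
  show "\<exists>T. x' \<in> T \<and> openin (top_of_set X') T \<and>
           (\<exists>v. \<Union> v = Y' \<inter> (i \<circ> p \<circ> e') -` T \<and> (\<forall>u\<in>v. openin (top_of_set Y') u) \<and>
             pairwise disjnt v \<and> (\<forall>u\<in>v. \<exists>q. homeomorphism u T (i \<circ> p \<circ> e') q))"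
  proof (intro exI[of _ "i ` T"] exI[of _ "(`) e ` V"] conjI ballI)
    show "x' \<in> i ` T"
      using T(1) x' hX by (metis homeomorphism_apply2 imageI)
    show "openin (top_of_set X') (i ` T)"
      by (rule homeomorphism_imp_open_map[OF hX T(2)])
    have "e ` (Y \<inter> p -` T) = Y' \<inter> (i \<circ> p \<circ> e') -` i ` T"
    proof (intro equalityI subsetI)
      fix z assume "z \<in> e ` (Y \<inter> p -` T)"
      then show "z \<in> Y' \<inter> (i \<circ> p \<circ> e') -` i ` T"
        using hY by (auto simp: homeomorphism_def)
    next
      fix z assume z: "z \<in> Y' \<inter> (i \<circ> p \<circ> e') -` i ` T"
      then obtain t where t: "t \<in> T" "i (p (e' z)) = i t" by auto
      have y: "e' z \<in> Y" "e (e' z) = z" using z hY by (auto simp: homeomorphism_def)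
      then have "p (e' z) \<in> X" using pY by blast
      then have "p (e' z) = t" using t TX hX by (metis homeomorphism_apply1 subsetD)
      then show "z \<in> e ` (Y \<inter> p -` T)" using y t by (auto intro!: image_eqI[of z e "e' z"])
    qed
    then show "\<Union> ((`) e ` V) = Y' \<inter> (i \<circ> p \<circ> e') -` i ` T"
      using V(1) by (metis image_Union)
    show "openin (top_of_set Y') u" if "u \<in> (`) e ` V" for u
      using that V(2) homeomorphism_imp_open_map[OF hY] by blast
    have "disjnt (e ` u) (e ` w)" if "u \<in> V" "w \<in> V" "u \<noteq> w" for u w
    proof -
      have "disjnt u w" using V(3) that by (auto simp: pairwise_def)
      moreover have "inj_on e Y" using hY by (metis homeomorphism_apply1 inj_on_inverseI)
      ultimately show ?thesis
        using VY that by (simp add: disjnt_def flip: inj_on_image_Int)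
    qed
    then show "pairwise disjnt ((`) e ` V)"
      by (auto simp: pairwise_def)
    show "\<exists>q. homeomorphism u (i ` T) (i \<circ> p \<circ> e') q" if "u \<in> (`) e ` V" for u
    proof -
      obtain w where w: "w \<in> V" "u = e ` w"
        using \<open>u \<in> (`) e ` V\<close> by blast
      obtain q where q: "homeomorphism w T p q"
        using V(4)[OF w(1)] by blast
      have 1: "homeomorphism u w e' e"
        using homeomorphism_of_subsets[OF hY VY[OF w(1)] order_refl] w(2)
        by (blast intro: homeomorphism_symD)
      have 2: "homeomorphism T (i ` T) i i'"
        using homeomorphism_of_subsets[OF hX TX order_refl] by blast
      show ?thesis
        using homeomorphism_compose[OF homeomorphism_compose[OF 1 q] 2]
        by (auto simp: comp_assoc)
    qed
  qed
qed

text \<open>The path is lifted in the embedded covering and the lift is pulled back along the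
  inverse of \<open>e\<close>; injectivity of \<open>i\<close> returns the projection equation to
  \<open>X\<close>.\<close>

lemma metric_covering_space_lift_path:
  fixes p :: "'b::metric_space \<Rightarrow> 'a::metric_space"
  assumes cov: "covering_space Y p X" and "a \<in> Y"
    and "path g" "path_image g \<subseteq> X" "pathstart g = p a"
  obtains h where "path h" "path_image h \<subseteq> Y" "pathstart h = a"
    "\<And>t. t \<in> {0..1} \<Longrightarrow> p (h t) = g t"
proof -
  obtain e :: "'b \<Rightarrow> ('b \<Rightarrow>\<^sub>C real)" where e: "\<And>x y. dist (e x) (e y) = dist x y"
    using kuratowski_embedding by blast
  obtain i :: "'a \<Rightarrow> ('a \<Rightarrow>\<^sub>C real)" where i: "\<And>x y. dist (i x) (i y) = dist x y"
    using kuratowski_embedding by blast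
  note hY = dist_preserving_imp_homeomorphism[OF e, where S = Y]
  note hX = dist_preserving_imp_homeomorphism[OF i, where S = X]
  have inj: "inj e" "inj i" using e i by (metis dist_eq_0_iff injI)+
  have cov': "covering_space (e ` Y) (i \<circ> p \<circ> inv_into UNIV e) (i ` X)"
    by (rule covering_space_homeomorphic_image[OF cov hY hX])
  have "path (i \<circ> g)"
    using assms hX by (meson continuous_on_subset homeomorphism_cont1 path_continuous_image)
  moreover have "path_image (i \<circ> g) \<subseteq> i ` X"
    using assms by (auto simp: path_image_compose)
  moreover have "pathstart (i \<circ> g) = (i \<circ> p \<circ> inv_into UNIV e) (e a)"
    using assms by (simp add: pathstart_compose inv_f_f[OF inj(1)])
  ultimately obtain h where h: "path h" "path_image h \<subseteq> e ` Y" "pathstart h = e a"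
    "\<And>t. t \<in> {0..1} \<Longrightarrow> (i \<circ> p \<circ> inv_into UNIV e) (h t) = (i \<circ> g) t"
    using covering_space_lift_path_strong[OF cov', of "e a"] \<open>a \<in> Y\<close> by (metis imageI)
  show ?thesis
  proof
    show "path (inv_into UNIV e \<circ> h)"
      using h hY by (meson continuous_on_subset homeomorphism_cont2 path_continuous_image)
    show "path_image (inv_into UNIV e \<circ> h) \<subseteq> Y"
      using h hY by (auto simp: path_image_compose inv_f_f[OF inj(1)])
    show "pathstart (inv_into UNIV e \<circ> h) = a"
      using h by (simp add: pathstart_compose inv_f_f[OF inj(1)])
    show "p ((inv_into UNIV e \<circ> h) t) = g t" if "t \<in> {0..1}" for t
      using h(4)[OF that] inj by (auto dest: injD)
  qed
qed

text \<open>The end points may be compared after applying the injective map \<open>e\<close>, and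
  there the monodromy theorem for normed spaces gives their equality.\<close>

lemma metric_covering_space_monodromy:
  fixes p :: "'b::metric_space \<Rightarrow> 'a::metric_space"
  assumes cov: "covering_space Y p X" and hom: "homotopic_paths X g1 g2"
    and h1: "path h1" "path_image h1 \<subseteq> Y" "\<And>t. t \<in> {0..1} \<Longrightarrow> p (h1 t) = g1 t"
    and h2: "path h2" "path_image h2 \<subseteq> Y" "\<And>t. t \<in> {0..1} \<Longrightarrow> p (h2 t) = g2 t"
    and start: "pathstart h1 = pathstart h2"
  shows "pathfinish h1 = pathfinish h2"
proof -
  obtain e :: "'b \<Rightarrow> ('b \<Rightarrow>\<^sub>C real)" where e: "\<And>x y. dist (e x) (e y) = dist x y"
    using kuratowski_embedding by blast
  obtain i :: "'a \<Rightarrow> ('a \<Rightarrow>\<^sub>C real)" where i: "\<And>x y. dist (i x) (i y) = dist x y"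
    using kuratowski_embedding by blast
  note hY = dist_preserving_imp_homeomorphism[OF e, where S = Y]
  note hX = dist_preserving_imp_homeomorphism[OF i, where S = X]
  have inj: "inj e" "inj i" using e i by (metis dist_eq_0_iff injI)+
  have cov': "covering_space (e ` Y) (i \<circ> p \<circ> inv_into UNIV e) (i ` X)"
    by (rule covering_space_homeomorphic_image[OF cov hY hX])
  have hom': "homotopic_paths (i ` X) (i \<circ> g1) (i \<circ> g2)"
    by (rule homotopic_paths_continuous_image[OF hom homeomorphism_cont1[OF hX]]) auto
  have pe: "path (e \<circ> h)" "path_image (e \<circ> h) \<subseteq> e ` Y" if "path h" "path_image h \<subseteq> Y" for h
    using that homeomorphism_cont1[OF hY]
    by (auto simp: path_image_compose intro: path_continuous_image continuous_on_subset)
  have "pathfinish (e \<circ> h1) = pathfinish (e \<circ> h2)"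
  proof (rule covering_space_monodromy[OF cov' _ _ _ _ hom'])
    show "path (i \<circ> g1)" "path (i \<circ> g2)" "path_image (i \<circ> g1) \<subseteq> i ` X" "path_image (i \<circ> g2) \<subseteq> i ` X"
      using homotopic_paths_imp_path[OF hom'] homotopic_paths_imp_subset[OF hom'] by auto
  qed (use pe h1 h2 start in \<open>auto simp: pathstart_compose inv_f_f[OF inj(1)]\<close>)
  then show ?thesis
    by (simp add: pathfinish_compose inj_eq[OF inj(1)])
qed

text \<open>This supplies the lift of \<open>\<sigma> \<circ> p\<close> to the universal cover. The
  domain gets an embedding \<open>j\<close> of its own, under which simple connectedness and local
  path connectedness survive as topological invariants.\<close>

lemma metric_covering_space_lift:
  fixes p :: "'b::metric_space \<Rightarrow> 'a::metric_space" and f :: "'c::metric_space \<Rightarrow> 'a"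
  assumes cov: "covering_space Y p X" and "a \<in> Y" "z \<in> U"
    and U: "simply_connected U" "locally path_connected U"
    and f: "continuous_on U f" "f \<in> U \<rightarrow> X" "f z = p a"
  obtains g where "continuous_on U g" "g \<in> U \<rightarrow> Y" "g z = a" "\<And>y. y \<in> U \<Longrightarrow> p (g y) = f y"
proof -
  obtain e :: "'b \<Rightarrow> ('b \<Rightarrow>\<^sub>C real)" where e: "\<And>x y. dist (e x) (e y) = dist x y"
    using kuratowski_embedding by blast
  obtain i :: "'a \<Rightarrow> ('a \<Rightarrow>\<^sub>C real)" where i: "\<And>x y. dist (i x) (i y) = dist x y"
    using kuratowski_embedding by blast
  obtain j :: "'c \<Rightarrow> ('c \<Rightarrow>\<^sub>C real)" where j: "\<And>x y. dist (j x) (j y) = dist x y"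
    using kuratowski_embedding by blast
  note hY = dist_preserving_imp_homeomorphism[OF e, where S = Y]
  note hX = dist_preserving_imp_homeomorphism[OF i, where S = X]
  note hU = dist_preserving_imp_homeomorphism[OF j, where S = U]
  have inj: "inj e" "inj i" "inj j" using e i j by (metis dist_eq_0_iff injI)+
  have cov': "covering_space (e ` Y) (i \<circ> p \<circ> inv_into UNIV e) (i ` X)"
    by (rule covering_space_homeomorphic_image[OF cov hY hX])
  have homU: "U homeomorphic j ` U"
    using hU homeomorphic_def by blast
  have sc: "simply_connected (j ` U)"
    using homeomorphic_simply_connected[OF homU U(1)] .
  have lpc: "locally path_connected (j ` U)"
    using homeomorphic_locally[OF homU] U(2) homeomorphic_path_connectedness by metis
  have cont: "continuous_on (j ` U) (i \<circ> f \<circ> inv_into UNIV j)"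
    using homeomorphism_cont2[OF hU] homeomorphism_image2[OF hU] f homeomorphism_cont1[OF hX]
    by (intro continuous_on_compose) (auto intro: continuous_on_subset)
  have im: "(i \<circ> f \<circ> inv_into UNIV j) \<in> j ` U \<rightarrow> i ` X" and fz: "(i \<circ> f \<circ> inv_into UNIV j) (j z) = (i \<circ> p \<circ> inv_into UNIV e) (e a)"
    using f by (auto simp: inv_f_f inj)
  obtain g where g: "continuous_on (j ` U) g" "g \<in> j ` U \<rightarrow> e ` Y" "g (j z) = e a"
    "\<And>y. y \<in> j ` U \<Longrightarrow> (i \<circ> p \<circ> inv_into UNIV e) (g y) = (i \<circ> f \<circ> inv_into UNIV j) y"
    using covering_space_lift_strong[OF cov' _ _ sc lpc cont im fz] assms(2,3) by blast
  show ?thesis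
  proof
    show "continuous_on U (inv_into UNIV e \<circ> g \<circ> j)"
      using homeomorphism_cont1[OF hU] g(1,2) homeomorphism_cont2[OF hY]
      by (intro continuous_on_compose) (auto intro: continuous_on_subset)
    show "inv_into UNIV e \<circ> g \<circ> j \<in> U \<rightarrow> Y"
      using g(2) by (force simp: inv_f_f inj)
    show "(inv_into UNIV e \<circ> g \<circ> j) z = a"
      by (simp add: g(3) inv_f_f inj)
    show "p ((inv_into UNIV e \<circ> g \<circ> j) y) = f y" if "y \<in> U" for y
      using g(4)[of "j y"] that by (auto simp: inv_f_f inj inj_eq)
  qed
qed

section \<open>Path homotopies in metric spaces\<close>

lemma homotopic_paths_homeomorphic_image_iff:
  assumes "homeomorphism S T e e'" "path_image g \<subseteq> S" "path_image h \<subseteq> S"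
  shows "homotopic_paths T (e \<circ> g) (e \<circ> h) \<longleftrightarrow> homotopic_paths S g h"
proof
  assume "homotopic_paths S g h"
  then show "homotopic_paths T (e \<circ> g) (e \<circ> h)"
    using assms by (auto intro: homotopic_paths_continuous_image simp: homeomorphism_def)
next
  assume "homotopic_paths T (e \<circ> g) (e \<circ> h)"
  then have *: "homotopic_paths S (e' \<circ> (e \<circ> g)) (e' \<circ> (e \<circ> h))"
    by (rule homotopic_paths_continuous_image) (use assms(1) in \<open>auto simp: homeomorphism_def\<close>)
  have "e' (e (k t)) = k t" if "path_image k \<subseteq> S" "t \<in> {0..1}" for k t
    using that assms(1) by (simp add: homeomorphism_def path_image_def image_subset_iff)
  \<comment> \<open>\<open>e'\<close> inverts \<open>e\<close> on \<open>S\<close> alone, so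
    \<open>e' \<circ> (e \<circ> k)\<close> agrees with \<open>k\<close> on the parameter interval
    but perhaps not outside it; such paths are still homotopic.\<close>
  then have "homotopic_paths S (e' \<circ> (e \<circ> k)) k"
    if "path (e' \<circ> (e \<circ> k))" "path_image (e' \<circ> (e \<circ> k)) \<subseteq> S" "path_image k \<subseteq> S" for k
    using that by (intro homotopic_paths_eq) auto
  then show "homotopic_paths S g h"
    using * assms(2,3) homotopic_paths_imp_path[OF *] homotopic_paths_imp_subset[OF *]
    by (meson homotopic_paths_sym homotopic_paths_trans)
qed

lemma metric_homotopic_paths_rid:
  fixes g :: "real \<Rightarrow> 'a::metric_space"
  assumes "path g" "path_image g \<subseteq> S" "pathfinish g = a"
  shows "homotopic_paths S (g +++ (\<lambda>_. a)) g"
proof -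
  obtain e :: "'a \<Rightarrow> ('a \<Rightarrow>\<^sub>C real)" where e: "\<And>x y. dist (e x) (e y) = dist x y"
    using kuratowski_embedding by blast
  note h = dist_preserving_imp_homeomorphism[OF e, where S = S]
  have "a \<in> S" using assms by (metis pathfinish_in_path_image subsetD)
  moreover have "homotopic_paths (e ` S) ((e \<circ> g) +++ linepath (e a) (e a)) (e \<circ> g)"
    using assms homeomorphism_cont1[OF h]
    by (intro homotopic_paths_rid')
      (auto simp: path_image_compose pathfinish_compose intro: path_continuous_image continuous_on_subset)
  then have "homotopic_paths (e ` S) (e \<circ> (g +++ (\<lambda>_. a))) (e \<circ> g)"
    by (simp add: path_compose_join linepath_refl comp_def[of e "\<lambda>_. a"])
  ultimately show ?thesis
    using assms by (subst (asm) homotopic_paths_homeomorphic_image_iff[OF h])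
      (auto simp: path_image_join path_image_const pathstart_def)
qed

text \<open>Reversal exchanges the two factors of a join, which reduces the left unit law for
  \<open>g\<close> to the right one for \<open>reversepath g\<close>.\<close>

lemma metric_homotopic_paths_lid:
  fixes g :: "real \<Rightarrow> 'a::metric_space"
  assumes "path g" "path_image g \<subseteq> S" "pathstart g = a"
  shows "homotopic_paths S ((\<lambda>_. a) +++ g) g"
proof -
  have "homotopic_paths S (reversepath g +++ (\<lambda>_. a)) (reversepath g)"
    using assms by (intro metric_homotopic_paths_rid) auto
  then have "homotopic_paths S (reversepath (reversepath g +++ (\<lambda>_. a))) g"
    by (metis homotopic_paths_reversepath reversepath_reversepath)
  moreover have "reversepath (\<lambda>_. a) = (\<lambda>_. a)"
    by (simp add: reversepath_def)
  ultimately show ?thesis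
    using assms(3) by (simp add: reversepath_joinpaths pathstart_def)
qed

lemma metric_homotopic_paths_linv:
  fixes g :: "real \<Rightarrow> 'a::metric_space"
  assumes "path g" "path_image g \<subseteq> S" "pathfinish g = a"
  shows "homotopic_paths S (reversepath g +++ g) (\<lambda>_. a)"
proof -
  obtain e :: "'a \<Rightarrow> ('a \<Rightarrow>\<^sub>C real)" where e: "\<And>x y. dist (e x) (e y) = dist x y"
    using kuratowski_embedding by blast
  note h = dist_preserving_imp_homeomorphism[OF e, where S = S]
  have "a \<in> S" using assms by (metis pathfinish_in_path_image subsetD)
  moreover have "homotopic_paths (e ` S) (reversepath (e \<circ> g) +++ (e \<circ> g)) (linepath (e a) (e a))"
    using assms homeomorphism_cont1[OF h] homotopic_paths_linv[of "e \<circ> g" "e ` S"]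
    by (auto simp: path_image_compose pathfinish_compose intro: path_continuous_image continuous_on_subset)
  then have "homotopic_paths (e ` S) (e \<circ> (reversepath g +++ g)) (e \<circ> (\<lambda>_. a))"
    by (simp add: path_compose_join path_compose_reversepath linepath_refl
        comp_def[of e "\<lambda>_. a"])
  ultimately show ?thesis
    using assms by (subst (asm) homotopic_paths_homeomorphic_image_iff[OF h])
      (auto simp: path_image_join path_image_reversepath path_image_const)
qed

lemma simply_connected_imp_homotopic_const:
  fixes h :: "real \<Rightarrow> 'a::metric_space"
  assumes "simply_connected S" "path h" "path_image h \<subseteq> S" "pathstart h = a" "pathfinish h = a"
  shows "homotopic_paths S h (\<lambda>_. a)"
proof -
  obtain e :: "'a \<Rightarrow> ('a \<Rightarrow>\<^sub>C real)" where e: "\<And>x y. dist (e x) (e y) = dist x y"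
    using kuratowski_embedding by blast
  note hS = dist_preserving_imp_homeomorphism[OF e, where S = S]
  have "a \<in> S" using assms by (metis pathstart_in_path_image subsetD)
  have "simply_connected (e ` S)"
    using homeomorphic_simply_connected assms(1) hS homeomorphic_def by metis
  moreover have "path (e \<circ> h)" "path_image (e \<circ> h) \<subseteq> e ` S"
    "pathstart (e \<circ> h) = e a" "pathfinish (e \<circ> h) = e a"
    using assms homeomorphism_cont1[OF hS]
    by (auto simp: path_image_compose pathfinish_compose pathstart_compose
        intro: path_continuous_image continuous_on_subset)
  ultimately have "homotopic_paths (e ` S) (e \<circ> h) (linepath (e a) (e a))"
    using simply_connected_eq_contractible_path by metis
  then have "homotopic_paths (e ` S) (e \<circ> h) (e \<circ> (\<lambda>_. a))"
    by (simp add: linepath_refl comp_def)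
  then show ?thesis
    using assms \<open>a \<in> S\<close> by (subst (asm) homotopic_paths_homeomorphic_image_iff[OF hS])
      (auto simp: path_image_def)
qed

section \<open>Semidirect products\<close>

locale semidirect = G: group G + H: group H
  for G :: "('g, 'm) monoid_scheme" and H :: "('h, 'n) monoid_scheme" +
  fixes \<phi> :: "'h \<Rightarrow> 'g \<Rightarrow> 'g"
  assumes act_hom: "h \<in> carrier H \<Longrightarrow> \<phi> h \<in> hom G G"
    and act_one: "x \<in> carrier G \<Longrightarrow> \<phi> \<one>\<^bsub>H\<^esub> x = x"
    and act_mult: "\<lbrakk>h \<in> carrier H; k \<in> carrier H; x \<in> carrier G\<rbrakk> \<Longrightarrow> \<phi> (h \<otimes>\<^bsub>H\<^esub> k) x = \<phi> h (\<phi> k x)"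
begin

abbreviation P where "P \<equiv> semidirect_product G H \<phi>"

lemma act_closed [simp]: "\<lbrakk>h \<in> carrier H; x \<in> carrier G\<rbrakk> \<Longrightarrow> \<phi> h x \<in> carrier G"
  using act_hom by (auto simp: hom_def)

lemma act_hom_mult: "\<lbrakk>h \<in> carrier H; x \<in> carrier G; y \<in> carrier G\<rbrakk>
    \<Longrightarrow> \<phi> h (x \<otimes>\<^bsub>G\<^esub> y) = \<phi> h x \<otimes>\<^bsub>G\<^esub> \<phi> h y"
  using act_hom by (auto simp: hom_def)

lemma act_hom_one: "h \<in> carrier H \<Longrightarrow> \<phi> h \<one>\<^bsub>G\<^esub> = \<one>\<^bsub>G\<^esub>"
  using act_hom hom_one G.group_axioms by blast

lemma act_hom_inv: "\<lbrakk>h \<in> carrier H; x \<in> carrier G\<rbrakk> \<Longrightarrow> \<phi> h (inv\<^bsub>G\<^esub> x) = inv\<^bsub>G\<^esub> (\<phi> h x)"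
  using group_hom.hom_inv[of G G "\<phi> h"] act_hom G.group_axioms
  by (simp add: group_hom_def group_hom_axioms_def)

lemma act_inverse: "\<lbrakk>h \<in> carrier H; x \<in> carrier G\<rbrakk> \<Longrightarrow> \<phi> h (\<phi> (inv\<^bsub>H\<^esub> h) x) = x"
  "\<lbrakk>h \<in> carrier H; x \<in> carrier G\<rbrakk> \<Longrightarrow> \<phi> (inv\<^bsub>H\<^esub> h) (\<phi> h x) = x"
  by (simp_all flip: act_mult add: act_one)

text \<open>The action laws make the map of the inverse of \<open>h\<close> a two-sided inverse of
  \<open>\<phi> h\<close>, so the endomorphism is bijective.\<close>

lemma act_iso: "h \<in> carrier H \<Longrightarrow> \<phi> h \<in> iso G G"
proof -
  assume h: "h \<in> carrier H"
  then have "bij_betw (\<phi> h) (carrier G) (carrier G)"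
    by (intro bij_betw_byWitness[where f' = "\<phi> (inv\<^bsub>H\<^esub> h)"]) (auto simp: act_inverse)
  then show ?thesis
    using h act_hom by (simp add: iso_def)
qed

lemma carrier_P: "carrier P = carrier G \<times> carrier H"
  and mult_P: "(x, h) \<otimes>\<^bsub>P\<^esub> (y, k) = (x \<otimes>\<^bsub>G\<^esub> \<phi> h y, h \<otimes>\<^bsub>H\<^esub> k)"
  and one_P: "\<one>\<^bsub>P\<^esub> = (\<one>\<^bsub>G\<^esub>, \<one>\<^bsub>H\<^esub>)"
  by (simp_all add: semidirect_product_def)

lemma group_P: "group P"
proof (rule groupI)
  fix a assume "a \<in> carrier P"
  then obtain x h where a: "a = (x, h)" "x \<in> carrier G" "h \<in> carrier H"
    by (auto simp: carrier_P)
  show "\<exists>b\<in>carrier P. b \<otimes>\<^bsub>P\<^esub> a = \<one>\<^bsub>P\<^esub>"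
  proof
    \<comment> \<open>A left inverse \<open>(u, k)\<close> of \<open>(x, h)\<close> must have
      \<open>k\<close> inverse to \<open>h\<close> and \<open>u\<close> inverse to
      \<open>\<phi> k x\<close>; this determines the witness.\<close>
    show "(\<phi> (inv\<^bsub>H\<^esub> h) (inv\<^bsub>G\<^esub> x), inv\<^bsub>H\<^esub> h) \<otimes>\<^bsub>P\<^esub> a = \<one>\<^bsub>P\<^esub>"
      using a by (simp add: mult_P one_P act_hom_one flip: act_hom_mult)
  qed (use a in \<open>simp add: carrier_P\<close>)
qed (auto simp: carrier_P mult_P one_P act_hom_mult act_mult act_one G.m_assoc H.m_assoc)

lemma subgroup_times:
  assumes K: "subgroup K G" and inv: "\<And>h x. \<lbrakk>h \<in> carrier H; x \<in> K\<rbrakk> \<Longrightarrow> \<phi> h x \<in> K"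
  shows "subgroup (K \<times> carrier H) P"
proof -
  interpret P: group P by (rule group_P)
  have sub: "x \<in> carrier G" if "x \<in> K" for x
    using that K by (simp add: subgroup.mem_carrier)
  show ?thesis
  proof (rule P.subgroupI)
    show "K \<times> carrier H \<subseteq> carrier P" by (auto simp: carrier_P sub)
    show "K \<times> carrier H \<noteq> {}" using subgroup.one_closed[OF K] H.one_closed by blast
  next
    fix a assume "a \<in> K \<times> carrier H"
    then obtain x h where a: "a = (x, h)" "x \<in> K" "h \<in> carrier H" by auto
    have "inv\<^bsub>P\<^esub> a = (\<phi> (inv\<^bsub>H\<^esub> h) (inv\<^bsub>G\<^esub> x), inv\<^bsub>H\<^esub> h)"
      using a sub by (intro P.inv_equality) (simp_all add: mult_P one_P carrier_P act_hom_one flip: act_hom_mult)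
    then show "inv\<^bsub>P\<^esub> a \<in> K \<times> carrier H"
      using a K inv by (simp add: subgroup.m_inv_closed)
  next
    fix a b assume "a \<in> K \<times> carrier H" "b \<in> K \<times> carrier H"
    then show "a \<otimes>\<^bsub>P\<^esub> b \<in> K \<times> carrier H"
      using K inv by (auto simp: mult_P subgroup.m_closed)
  qed
qed

lemma pow_P_snd: "s \<in> carrier H \<Longrightarrow> (\<one>\<^bsub>G\<^esub>, s) [^]\<^bsub>P\<^esub> (n::nat) = (\<one>\<^bsub>G\<^esub>, s [^]\<^bsub>H\<^esub> n)"
proof (induction n)
  case 0
  interpret P: group P by (rule group_P)
  show ?case by (simp add: one_P)
next
  case (Suc n)
  interpret P: group P by (rule group_P)
  from Suc show ?case by (simp add: mult_P act_hom_one)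
qed

end

section \<open>Orders and conjugation\<close>

lemma (in group) pow_conjugate:
  assumes "a \<in> carrier G" "b \<in> carrier G"
  shows "(a \<otimes> b \<otimes> inv a) [^] (n::nat) = a \<otimes> b [^] n \<otimes> inv a"
proof (induction n)
  case (Suc n)
  have "a \<otimes> b [^] n \<otimes> inv a \<otimes> (a \<otimes> b \<otimes> inv a) = a \<otimes> b [^] n \<otimes> (inv a \<otimes> a) \<otimes> b \<otimes> inv a"
    using assms by (simp only: m_assoc m_closed inv_closed nat_pow_closed)
  with Suc assms show ?case
    by (simp add: m_assoc)
qed (use assms in simp)

text \<open>An exponent kills the conjugate exactly when it kills \<open>b\<close>: powers commute
  with conjugation, and only the identity is conjugate to the identity.\<close>

lemma (in group) ord_conjugate:
  assumes "a \<in> carrier G" "b \<in> carrier G"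
  shows "ord (a \<otimes> b \<otimes> inv a) = ord b"
proof -
  have "a \<otimes> y \<otimes> inv a = \<one> \<longleftrightarrow> y = \<one>" if "y \<in> carrier G" for y
    using that assms by (simp add: inv_solve_right')
  then show ?thesis
    using assms by (subst ord_unique) (simp_all add: pow_conjugate pow_eq_id)
qed

lemma (in group) ord_subgroup:
  assumes "subgroup K G" "x \<in> K"
  shows "group.ord (G\<lparr>carrier := K\<rparr>) x = ord x"
proof -
  interpret K: group "G\<lparr>carrier := K\<rparr>"
    using assms(1) by (rule subgroup_imp_group)
  show ?thesis
    using assms by (subst K.ord_unique)
      (auto simp: pow_eq_id subgroup.mem_carrier simp flip: nat_pow_consistent)
qed

lemma (in group) conjugacy_class_refl: "x \<in> carrier G \<Longrightarrow> x \<in> conjugacy_class G x"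
  unfolding conjugacy_class_def by (auto intro!: exI[of _ \<one>])

section \<open>Conjugates of an element of the acting group\<close>

context semidirect
begin

text \<open>The equation says that \<open>(k, h)\<close> conjugates the translate of
  \<open>s\<close> by \<open>x\<close> into the one by \<open>y\<close>. In its first coordinate
  \<open>\<phi> h (\<phi> s x)\<close> equals \<open>\<phi> s (\<phi> h x)\<close> because
  \<open>h\<close> and \<open>s\<close> commute. Multiplying by the inverse of \<open>y\<close> on
  the left and by \<open>\<phi> s (\<phi> h x)\<close> on the right leaves \<open>\<phi> s z\<close>
  on one side and \<open>z\<close> on the other.\<close>

lemma conjugate_imp_fixed:
  assumes x: "x \<in> carrier G" and y: "y \<in> carrier G" and k: "k \<in> carrier G"
    and h: "h \<in> carrier H" and s: "s \<in> carrier H" and comm: "h \<otimes>\<^bsub>H\<^esub> s = s \<otimes>\<^bsub>H\<^esub> h"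
    and eq: "(y \<otimes>\<^bsub>G\<^esub> inv\<^bsub>G\<^esub> (\<phi> s y), s) \<otimes>\<^bsub>P\<^esub> (k, h) = (k, h) \<otimes>\<^bsub>P\<^esub> (x \<otimes>\<^bsub>G\<^esub> inv\<^bsub>G\<^esub> (\<phi> s x), s)"
  defines "z \<equiv> inv\<^bsub>G\<^esub> y \<otimes>\<^bsub>G\<^esub> (k \<otimes>\<^bsub>G\<^esub> \<phi> h x)"
  shows "\<phi> s z = z"
proof -
  define u where "u = \<phi> s (\<phi> h x)"
  have u: "u \<in> carrier G" using x h s by (simp add: u_def)
  have "\<phi> h (\<phi> s x) = u"
    using x h s comm by (simp add: u_def flip: act_mult)
  then have "y \<otimes>\<^bsub>G\<^esub> inv\<^bsub>G\<^esub> (\<phi> s y) \<otimes>\<^bsub>G\<^esub> \<phi> s k = k \<otimes>\<^bsub>G\<^esub> (\<phi> h x \<otimes>\<^bsub>G\<^esub> inv\<^bsub>G\<^esub> u)"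
    using eq x y k h s by (simp add: mult_P act_hom_mult act_hom_inv)
  then have "inv\<^bsub>G\<^esub> y \<otimes>\<^bsub>G\<^esub> (y \<otimes>\<^bsub>G\<^esub> inv\<^bsub>G\<^esub> (\<phi> s y) \<otimes>\<^bsub>G\<^esub> \<phi> s k) \<otimes>\<^bsub>G\<^esub> u
      = inv\<^bsub>G\<^esub> y \<otimes>\<^bsub>G\<^esub> (k \<otimes>\<^bsub>G\<^esub> (\<phi> h x \<otimes>\<^bsub>G\<^esub> inv\<^bsub>G\<^esub> u)) \<otimes>\<^bsub>G\<^esub> u"
    by simp
  moreover have "inv\<^bsub>G\<^esub> y \<otimes>\<^bsub>G\<^esub> (y \<otimes>\<^bsub>G\<^esub> inv\<^bsub>G\<^esub> (\<phi> s y) \<otimes>\<^bsub>G\<^esub> \<phi> s k) \<otimes>\<^bsub>G\<^esub> u = \<phi> s z"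
    using x y k h s u
    by (simp add: z_def act_hom_mult act_hom_inv u_def G.m_assoc G.inv_solve_left')
  moreover have "inv\<^bsub>G\<^esub> y \<otimes>\<^bsub>G\<^esub> (k \<otimes>\<^bsub>G\<^esub> (\<phi> h x \<otimes>\<^bsub>G\<^esub> inv\<^bsub>G\<^esub> u)) \<otimes>\<^bsub>G\<^esub> u = z"
    using x y k h s u by (simp add: z_def G.m_assoc)
  ultimately show ?thesis by simp
qed

lemma conjugate_P:
  assumes x: "x \<in> carrier G" and s: "s \<in> carrier H"
  shows "(x, \<one>\<^bsub>H\<^esub>) \<otimes>\<^bsub>P\<^esub> (\<one>\<^bsub>G\<^esub>, s) \<otimes>\<^bsub>P\<^esub> inv\<^bsub>P\<^esub> (x, \<one>\<^bsub>H\<^esub>) = (x \<otimes>\<^bsub>G\<^esub> inv\<^bsub>G\<^esub> (\<phi> s x), s)"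
proof -
  interpret P: group P by (rule group_P)
  have "inv\<^bsub>P\<^esub> (x, \<one>\<^bsub>H\<^esub>) = (inv\<^bsub>G\<^esub> x, \<one>\<^bsub>H\<^esub>)"
    using x by (intro P.inv_equality) (simp_all add: mult_P one_P carrier_P act_one)
  then show ?thesis
    using x s by (simp add: mult_P act_one act_hom_inv)
qed

lemma ord_conjugacy_class_P:
  assumes "s \<in> carrier H" "x \<in> conjugacy_class P (\<one>\<^bsub>G\<^esub>, s)"
  shows "group.ord P x = H.ord s"
proof -
  interpret P: group P by (rule group_P)
  have "P.ord x = P.ord (\<one>\<^bsub>G\<^esub>, s)"
    using assms by (auto simp: conjugacy_class_def carrier_P P.ord_conjugate)
  also have "\<dots> = H.ord s"
    using assms by (subst P.ord_unique) (simp_all add: carrier_P pow_P_snd one_P H.pow_eq_id)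
  finally show ?thesis .
qed

text \<open>Each element of the infinite group \<open>Q\<close> yields its own class. If
  \<open>c x\<close> and \<open>c y\<close> are conjugate in \<open>N\<close>, the element of
  \<open>conjugate_imp_fixed\<close> is fixed by \<open>s\<close> and therefore trivial; its image
  under \<open>\<pi>\<close> then shows \<open>\<pi> x = \<pi> y\<close>.\<close>

lemma infinite_conjugacy_classes:
  fixes Q :: "('q, 'r) monoid_scheme"
  assumes Q: "group Q" "infinite (carrier Q)" and \<pi>: "\<pi> \<in> epi G Q"
    and equivariant: "\<And>h x. \<lbrakk>h \<in> carrier H; x \<in> carrier G\<rbrakk> \<Longrightarrow> \<pi> (\<phi> h x) = \<pi> x"
    and s: "s \<in> carrier H" and comm: "\<And>h. h \<in> carrier H \<Longrightarrow> h \<otimes>\<^bsub>H\<^esub> s = s \<otimes>\<^bsub>H\<^esub> h"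
    and fixed: "\<And>x. \<lbrakk>x \<in> carrier G; \<phi> s x = x\<rbrakk> \<Longrightarrow> x = \<one>\<^bsub>G\<^esub>"
  defines "N \<equiv> kernel G Q \<pi> \<times> carrier H"
  shows "infinite {conjugacy_class (P\<lparr>carrier := N\<rparr>) x |x. x \<in> conjugacy_class P (\<one>\<^bsub>G\<^esub>, s) \<inter> N}"
proof -
  interpret P: group P by (rule group_P)
  interpret Q: group Q by (rule Q)
  interpret \<pi>: group_hom G Q \<pi>
    using \<pi> by unfold_locales (simp add: epi_def)
  have kerD: "k \<in> carrier G" "\<pi> k = \<one>\<^bsub>Q\<^esub>" if "k \<in> kernel G Q \<pi>" for k
    using that by (auto simp: kernel_def)
  have N: "subgroup N P"
    unfolding N_def using equivariant
    by (intro subgroup_times \<pi>.subgroup_kernel) (auto simp: kernel_def)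
  interpret N: group "P\<lparr>carrier := N\<rparr>" by (rule P.subgroup_imp_group[OF N])
  \<comment> \<open>By \<open>conjugate_P\<close>, \<open>c x\<close> is the conjugate of the
    element \<open>s\<close> by \<open>x\<close>, written in coordinates.\<close>
  define c where "c x = (x \<otimes>\<^bsub>G\<^esub> inv\<^bsub>G\<^esub> (\<phi> s x), s)" for x
  \<comment> \<open>A set-theoretic section of the epimorphism \<open>\<pi>\<close>; it indexes the
    classes by \<open>Q\<close>.\<close>
  define r where "r q = (SOME x. x \<in> carrier G \<and> \<pi> x = q)" for q
  have r: "r q \<in> carrier G" "\<pi> (r q) = q" if "q \<in> carrier Q" for q
  proof -
    have "q \<in> \<pi> ` carrier G"
      using that \<pi> by (simp add: epi_def)
    then have "\<exists>x. x \<in> carrier G \<and> \<pi> x = q"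
      by auto
    then have "r q \<in> carrier G \<and> \<pi> (r q) = q"
      unfolding r_def by (rule someI_ex)
    then show "r q \<in> carrier G" "\<pi> (r q) = q" by auto
  qed
  \<comment> \<open>\<open>\<pi>\<close> takes the same value on \<open>x\<close> and
    \<open>\<phi> s x\<close>, hence kills the first coordinate of \<open>c x\<close>.\<close>
  have cN: "c x \<in> N" if "x \<in> carrier G" for x
    using that s by (simp add: c_def N_def kernel_def equivariant)
  have cP: "c x \<in> conjugacy_class P (\<one>\<^bsub>G\<^esub>, s)" if "x \<in> carrier G" for x
    unfolding conjugacy_class_def mem_Collect_eq c_def
    by (rule exI[of _ "(x, \<one>\<^bsub>H\<^esub>)"]) (simp add: conjugate_P[OF that s] carrier_P that)
  have "\<pi> x = \<pi> y"
    if x: "x \<in> carrier G" and y: "y \<in> carrier G"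
      and eq: "conjugacy_class (P\<lparr>carrier := N\<rparr>) (c x) = conjugacy_class (P\<lparr>carrier := N\<rparr>) (c y)" for x y
  proof -
    have "c y \<in> conjugacy_class (P\<lparr>carrier := N\<rparr>) (c x)"
      using N.conjugacy_class_refl[of "c y"] cN[OF y] eq by simp
    then obtain a where a: "a \<in> N" "c y = a \<otimes>\<^bsub>P\<^esub> c x \<otimes>\<^bsub>P\<^esub> inv\<^bsub>P\<^esub> a"
      using P.m_inv_consistent[OF N] by (auto simp: conjugacy_class_def)
    obtain k h where kh: "a = (k, h)" "k \<in> kernel G Q \<pi>" "h \<in> carrier H"
      using a(1) by (auto simp: N_def)
    have mem: "a \<in> carrier P" "c x \<in> carrier P" "c y \<in> carrier P"
      using a(1) cN[OF x] cN[OF y] subgroup.mem_carrier[OF N] by auto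
    then have "c y \<otimes>\<^bsub>P\<^esub> a = a \<otimes>\<^bsub>P\<^esub> c x"
      using a(2) by (simp add: P.m_assoc)
    then have "\<phi> s (inv\<^bsub>G\<^esub> y \<otimes>\<^bsub>G\<^esub> (k \<otimes>\<^bsub>G\<^esub> \<phi> h x)) = inv\<^bsub>G\<^esub> y \<otimes>\<^bsub>G\<^esub> (k \<otimes>\<^bsub>G\<^esub> \<phi> h x)"
      using x y s kh kerD comm unfolding c_def by (intro conjugate_imp_fixed) auto
    then have "inv\<^bsub>G\<^esub> y \<otimes>\<^bsub>G\<^esub> (k \<otimes>\<^bsub>G\<^esub> \<phi> h x) = \<one>\<^bsub>G\<^esub>"
      using fixed x y kh kerD by simp
    then have "\<pi> (inv\<^bsub>G\<^esub> y \<otimes>\<^bsub>G\<^esub> (k \<otimes>\<^bsub>G\<^esub> \<phi> h x)) = \<one>\<^bsub>Q\<^esub>"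
      by simp
    \<comment> \<open>\<open>\<pi>\<close> kills the kernel element \<open>k\<close> and is
      invariant under \<open>h\<close>, so only \<open>x\<close> and \<open>y\<close> leave a trace
      in \<open>Q\<close>.\<close>
    then have "inv\<^bsub>Q\<^esub> (\<pi> y) \<otimes>\<^bsub>Q\<^esub> \<pi> x = \<one>\<^bsub>Q\<^esub>"
      using x y kh kerD by (simp add: equivariant)
    then show ?thesis
      using x y by (metis Q.inv_equality Q.inv_inv \<pi>.hom_closed Q.inv_closed)
  qed
  then have "inj_on (\<lambda>q. conjugacy_class (P\<lparr>carrier := N\<rparr>) (c (r q))) (carrier Q)"
    using r by (intro inj_onI) metis
  then have "infinite ((\<lambda>q. conjugacy_class (P\<lparr>carrier := N\<rparr>) (c (r q))) ` carrier Q)"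
    using Q(2) finite_imageD by blast
  moreover have "(\<lambda>q. conjugacy_class (P\<lparr>carrier := N\<rparr>) (c (r q))) ` carrier Q
      \<subseteq> {conjugacy_class (P\<lparr>carrier := N\<rparr>) x |x. x \<in> conjugacy_class P (\<one>\<^bsub>G\<^esub>, s) \<inter> N}"
    using r cN cP by blast
  ultimately show ?thesis
    using finite_subset by blast
qed

end

section \<open>Fundamental groups\<close>

lemma path_class_eq_iff:
  assumes "path g" "path_image g \<subseteq> S"
  shows "path_class S g = path_class S h \<longleftrightarrow> homotopic_paths S g h"
proof
  assume "path_class S g = path_class S h"
  moreover have "g \<in> path_class S g"
    using assms by (simp add: path_class_def)
  ultimately show "homotopic_paths S g h"
    by (simp add: path_class_def homotopic_paths_sym)
next
  assume "homotopic_paths S g h"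
  then show "path_class S g = path_class S h"
    unfolding path_class_def by (auto intro: homotopic_paths_sym homotopic_paths_trans)
qed

definition loop_at :: "'a::topological_space set \<Rightarrow> 'a \<Rightarrow> (real \<Rightarrow> 'a) \<Rightarrow> bool" where
  "loop_at S v g \<longleftrightarrow> path g \<and> path_image g \<subseteq> S \<and> pathstart g = v \<and> pathfinish g = v"

lemma loop_at_join: "loop_at S v g \<Longrightarrow> loop_at S v h \<Longrightarrow> loop_at S v (g +++ h)"
  by (simp add: loop_at_def subset_path_image_join)

lemma loop_at_compose:
  "loop_at S v g \<Longrightarrow> continuous_on S f \<Longrightarrow> f \<in> S \<rightarrow> T \<Longrightarrow> loop_at T (f v) (f \<circ> g)"
  unfolding loop_at_def
  by (auto simp: path_image_compose pathstart_compose pathfinish_compose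
      intro: path_continuous_image continuous_on_subset)

lemma path_class_cong: "homotopic_paths S g h \<Longrightarrow> path_class S g = path_class S h"
  using path_class_eq_iff homotopic_paths_imp_path homotopic_paths_imp_subset by metis

lemma loop_class_eq_iff:
  "loop_at S v g \<Longrightarrow> path_class S g = path_class S h \<longleftrightarrow> homotopic_paths S g h"
  by (simp add: loop_at_def path_class_eq_iff)

lemma carrier_fundamental_group: "carrier (fundamental_group S v) = path_class S ` Collect (loop_at S v)"
  by (simp add: fundamental_group_def loop_at_def[abs_def])

lemma one_fundamental_group: "\<one>\<^bsub>fundamental_group S v\<^esub> = path_class S (\<lambda>_. v)"
  by (simp add: fundamental_group_def)

text \<open>The product in \<open>fundamental_group\<close> is a union over all pairs of
  representatives. Homotopies can be joined, so every set in this union is the same class, and the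
  union is over a non-empty family.\<close>

lemma mult_fundamental_group:
  assumes g: "loop_at S v g" and h: "loop_at S v h"
  shows "path_class S g \<otimes>\<^bsub>fundamental_group S v\<^esub> path_class S h = path_class S (g +++ h)"
proof -
  have "path_class S (g' +++ h') = path_class S (g +++ h)"
    if "g' \<in> path_class S g" "h' \<in> path_class S h" for g' h'
  proof (rule path_class_cong[symmetric], rule homotopic_paths_join)
    show "pathfinish g = pathstart h"
      using g h by (simp add: loop_at_def)
  qed (use that in \<open>auto simp: path_class_def\<close>)
  moreover have "g \<in> path_class S g" "h \<in> path_class S h"
    using g h by (auto simp: path_class_def loop_at_def)
  ultimately have "(\<Union>\<gamma>\<in>path_class S g. \<Union>\<delta>\<in>path_class S h. path_class S (\<gamma> +++ \<delta>)) = path_class S (g +++ h)"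
    by blast
  then show ?thesis
    by (simp add: fundamental_group_def)
qed

lemma group_fundamental_group:
  fixes S :: "'a::metric_space set"
  assumes v: "v \<in> S"
  shows "group (fundamental_group S v)"
proof (rule groupI)
  have const: "loop_at S v (\<lambda>_. v)"
    using v by (simp add: loop_at_def path_def pathstart_def pathfinish_def)
  show "\<one>\<^bsub>fundamental_group S v\<^esub> \<in> carrier (fundamental_group S v)"
    using const by (auto simp: carrier_fundamental_group one_fundamental_group)
  fix a assume "a \<in> carrier (fundamental_group S v)"
  then obtain g where g: "loop_at S v g" "a = path_class S g"
    by (auto simp: carrier_fundamental_group)
  have "path_class S ((\<lambda>_. v) +++ g) = path_class S g"
    using g by (intro path_class_cong metric_homotopic_paths_lid) (auto simp: loop_at_def)
  then show "\<one>\<^bsub>fundamental_group S v\<^esub> \<otimes>\<^bsub>fundamental_group S v\<^esub> a = a"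
    using g const by (simp add: one_fundamental_group mult_fundamental_group)
  have r: "loop_at S v (reversepath g)"
    using g(1) by (simp add: loop_at_def)
  have "path_class S (reversepath g +++ g) = path_class S (\<lambda>_. v)"
    using g by (intro path_class_cong metric_homotopic_paths_linv) (auto simp: loop_at_def)
  then have "path_class S (reversepath g) \<otimes>\<^bsub>fundamental_group S v\<^esub> a = \<one>\<^bsub>fundamental_group S v\<^esub>"
    using g r by (simp add: one_fundamental_group mult_fundamental_group)
  then show "\<exists>b\<in>carrier (fundamental_group S v).
      b \<otimes>\<^bsub>fundamental_group S v\<^esub> a = \<one>\<^bsub>fundamental_group S v\<^esub>"
    using r by (auto simp: carrier_fundamental_group)
  fix b assume "b \<in> carrier (fundamental_group S v)"
  then obtain h where h: "loop_at S v h" "b = path_class S h"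
    by (auto simp: carrier_fundamental_group)
  show "a \<otimes>\<^bsub>fundamental_group S v\<^esub> b \<in> carrier (fundamental_group S v)"
    using g h loop_at_join[OF g(1) h(1)]
    by (auto simp: carrier_fundamental_group mult_fundamental_group)
  fix c assume "c \<in> carrier (fundamental_group S v)"
  then obtain k where k: "loop_at S v k" "c = path_class S k"
    by (auto simp: carrier_fundamental_group)
  have "homotopic_paths S (g +++ (h +++ k)) ((g +++ h) +++ k)"
    using g(1) h(1) k(1) by (intro homotopic_paths_assoc) (auto simp: loop_at_def)
  then have "path_class S ((g +++ h) +++ k) = path_class S (g +++ (h +++ k))"
    using path_class_cong by metis
  then show "a \<otimes>\<^bsub>fundamental_group S v\<^esub> b \<otimes>\<^bsub>fundamental_group S v\<^esub> c =
      a \<otimes>\<^bsub>fundamental_group S v\<^esub> (b \<otimes>\<^bsub>fundamental_group S v\<^esub> c)"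
    using g h k by (simp add: mult_fundamental_group loop_at_join)
qed

section \<open>Homomorphisms induced by continuous maps\<close>

lemma induced_map_path_class:
  assumes "path g" "path_image g \<subseteq> S" "continuous_on S f" "f \<in> S \<rightarrow> T"
  shows "induced_map T f (path_class S g) = path_class T (f \<circ> g)"
proof -
  have "path_class T (f \<circ> h) = path_class T (f \<circ> g)" if "h \<in> path_class S g" for h
    using that assms unfolding path_class_def mem_Collect_eq
    by (intro path_class_cong[symmetric, unfolded path_class_def] homotopic_paths_continuous_image)
  moreover have "g \<in> path_class S g"
    using assms by (simp add: path_class_def)
  ultimately show ?thesis
    unfolding induced_map_def by blast
qed

lemma induced_map_loop_class:
  "loop_at S v g \<Longrightarrow> continuous_on S f \<Longrightarrow> f \<in> S \<rightarrow> T \<Longrightarrow>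
    induced_map T f (path_class S g) = path_class T (f \<circ> g)"
  by (simp add: loop_at_def induced_map_path_class)

lemma induced_map_hom:
  assumes f: "continuous_on S f" "f \<in> S \<rightarrow> T"
  shows "induced_map T f \<in> hom (fundamental_group S v) (fundamental_group T (f v))"
proof (rule homI)
  fix a assume "a \<in> carrier (fundamental_group S v)"
  then obtain g where g: "loop_at S v g" "a = path_class S g"
    by (auto simp: carrier_fundamental_group)
  show "induced_map T f a \<in> carrier (fundamental_group T (f v))"
    using g f by (simp add: induced_map_loop_class carrier_fundamental_group loop_at_compose)
  fix b assume "b \<in> carrier (fundamental_group S v)"
  then obtain h where h: "loop_at S v h" "b = path_class S h"
    by (auto simp: carrier_fundamental_group)
  show "induced_map T f (a \<otimes>\<^bsub>fundamental_group S v\<^esub> b)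
      = induced_map T f a \<otimes>\<^bsub>fundamental_group T (f v)\<^esub> induced_map T f b"
    using g h f
    by (simp add: induced_map_loop_class[OF loop_at_join[OF g(1) h(1)] f] induced_map_loop_class[of S v]
        mult_fundamental_group loop_at_compose path_compose_join)
qed

text \<open>Agreement of \<open>l\<close> with \<open>k \<circ> f\<close> is asked on
  \<open>S\<close> only, since products in \<open>isometry_group\<close> are compositions restricted
  to the space. The case where \<open>k\<close> and \<open>l\<close> are both the circle-valued map
  expresses its invariance under an isometry.\<close>

lemma induced_map_compose:
  assumes f: "continuous_on S f" "f \<in> S \<rightarrow> T" and k: "continuous_on T k" "k \<in> T \<rightarrow> U"
    and l: "\<And>x. x \<in> S \<Longrightarrow> l x = k (f x)" and a: "a \<in> carrier (fundamental_group S v)"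
  shows "induced_map U l a = induced_map U k (induced_map T f a)"
proof -
  obtain g where g: "loop_at S v g" "a = path_class S g"
    using a by (auto simp: carrier_fundamental_group)
  have kf: "continuous_on S (k \<circ> f)"
    using f k by (intro continuous_on_compose) (auto intro: continuous_on_subset)
  then have "continuous_on S l"
    using l by (simp cong: continuous_on_cong)
  moreover have "l \<in> S \<rightarrow> U"
    using f k l by auto
  ultimately have L: "loop_at U (l v) (l \<circ> g)" "induced_map U l a = path_class U (l \<circ> g)"
    using g by (simp_all add: loop_at_compose induced_map_loop_class)
  have "homotopic_paths U (l \<circ> g) (k \<circ> (f \<circ> g))"
    using L(1) g(1) l by (intro homotopic_paths_eq) (auto simp: loop_at_def path_image_def image_subset_iff)
  then show ?thesis
    using L g f k by (simp add: induced_map_loop_class[of T "f v"] induced_map_loop_class[of S v]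
        loop_at_compose path_class_cong)
qed

lemma induced_map_ident:
  assumes "\<And>x. x \<in> S \<Longrightarrow> l x = x" and a: "a \<in> carrier (fundamental_group S v)"
  shows "induced_map S l a = a"
proof -
  obtain g where g: "loop_at S v g" "a = path_class S g"
    using a by (auto simp: carrier_fundamental_group)
  have "continuous_on S l" "l \<in> S \<rightarrow> S"
    using assms(1) by (auto cong: continuous_on_cong)
  then have "induced_map S l a = path_class S (l \<circ> g)"
    using g by (simp add: induced_map_loop_class)
  moreover have "homotopic_paths S g (l \<circ> g)"
    using g(1) assms(1) by (intro homotopic_paths_eq) (auto simp: loop_at_def path_image_def image_subset_iff)
  ultimately show ?thesis
    using g path_class_cong by metis
qed

text \<open>The loop \<open>g n\<close> winds \<open>n\<close> times around the circle, and
  \<open>h n\<close> is its lift through \<open>exp\<close> starting at \<open>Ln z\<close>. The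
  lifts end at different points, so by monodromy the loops are pairwise not homotopic.\<close>

lemma infinite_fundamental_group_circle:
  assumes "z \<in> circle"
  shows "infinite (carrier (fundamental_group circle z))"
proof -
  have nz: "z \<noteq> 0" and norm: "cmod z = 1" using assms by auto
  define h where "h n t = Ln z + 2 * pi * n * t * \<i>" for n :: nat and t :: real
  define g where "g n = exp \<circ> h n" for n
  have ph: "path (h n)" for n
    unfolding path_def h_def by (intro continuous_intros)
  have "cmod (exp (h n t)) = 1" for n t
    using norm nz by (simp add: h_def exp_add norm_mult norm_exp_eq_Re)
  then have im: "path_image (g n) \<subseteq> circle" for n
    by (auto simp: g_def path_image_def)
  have pg: "path (g n)" for n
    unfolding g_def using ph by (intro path_continuous_image continuous_intros)
  have "exp (2 * pi * n * \<i>) = 1" for n :: nat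
    using exp_integer_2pi[of "of_nat n"] by (simp add: mult.commute mult.left_commute)
  then have loop: "loop_at circle z (g n)" for n
    using pg im nz by (simp add: loop_at_def g_def h_def pathstart_def pathfinish_def exp_add)
  have "m = n" if "path_class circle (g m) = path_class circle (g n)" for m n
  proof -
    have "homotopic_paths circle (g m) (g n)"
      using that loop loop_class_eq_iff by blast
    \<comment> \<open>The homotopy is viewed in the punctured plane, the base of the covering
      \<open>exp\<close>.\<close>
    then have hom: "homotopic_paths (- {0}) (g m) (g n)"
      by (rule homotopic_paths_subset) auto
    have "pathfinish (h m) = pathfinish (h n)"
      by (rule covering_space_monodromy[OF covering_space_exp_punctured_plane pg _ pg _ hom ph _ _ ph])
        (use im in \<open>auto simp: g_def h_def pathstart_def path_image_def\<close>)
    then show ?thesis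
      by (simp add: h_def pathfinish_def)
  qed
  then have "inj (\<lambda>n. path_class circle (g n))"
    by (rule injI)
  then have "infinite (range (\<lambda>n. path_class circle (g n)))"
    by (simp add: finite_image_iff)
  moreover have "range (\<lambda>n. path_class circle (g n)) \<subseteq> carrier (fundamental_group circle z)"
    using loop by (auto simp: carrier_fundamental_group)
  ultimately show ?thesis
    using finite_subset by blast
qed

section \<open>Geodesics, coverings and links\<close>

lemma dist_ends_le_curve_length: "ennreal (dist (\<gamma> 0) (\<gamma> 1)) \<le> curve_length \<gamma>"
proof -
  \<comment> \<open>The coarsest subdivision. Subdivisions are monotone sequences on all of
    \<open>nat\<close>, so this one stays at 1 after its first step.\<close>
  define t :: "nat \<Rightarrow> real" where "t i = (if i = 0 then 0 else 1)" for i
  have "mono t" "range t \<subseteq> {0..1}"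
    by (auto simp: mono_def t_def)
  then have "(\<Sum>i<1. ennreal (dist (\<gamma> (t i)) (\<gamma> (t (Suc i))))) \<le> curve_length \<gamma>"
    unfolding curve_length_def by (intro SUP_upper2[of "(1, t)"]) auto
  then show ?thesis
    by (simp add: t_def)
qed

text \<open>For each subdivision the Lipschitz bounds telescope to \<open>(t n - t 0) * d\<close>,
  and the parameters lie in an interval of length 1.\<close>

lemma curve_length_le:
  assumes "0 \<le> d" and lip: "\<And>s t. \<lbrakk>s \<in> {0..1}; t \<in> {0..1}\<rbrakk> \<Longrightarrow> dist (\<gamma> s) (\<gamma> t) \<le> \<bar>s - t\<bar> * d"
  shows "curve_length \<gamma> \<le> ennreal d"
  unfolding curve_length_def
proof (rule SUP_least, clarify)
  fix n :: nat and t :: "nat \<Rightarrow> real"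
  assume t: "mono t" "range t \<subseteq> {0..1}"
  then have t01: "t i \<in> {0..1}" for i by (simp add: image_subset_iff)
  have "(\<Sum>i<n. ennreal (dist (\<gamma> (t i)) (\<gamma> (t (Suc i))))) \<le> (\<Sum>i<n. ennreal ((t (Suc i) - t i) * d))"
  proof (intro sum_mono ennreal_leI)
    fix i
    have "t i \<le> t (Suc i)" using t(1) by (simp add: mono_def)
    then show "dist (\<gamma> (t i)) (\<gamma> (t (Suc i))) \<le> (t (Suc i) - t i) * d"
      using lip[OF t01[of i] t01[of "Suc i"]] by simp
  qed
  also have "\<dots> = ennreal (\<Sum>i<n. (t (Suc i) - t i) * d)"
    using assms(1) t(1) by (intro sum_ennreal) (simp add: mono_def)
  also have "(\<Sum>i<n. (t (Suc i) - t i) * d) = (t n - t 0) * d"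
    by (simp flip: sum_distrib_right add: sum_lessThan_telescope)
  also have "ennreal \<dots> \<le> ennreal d"
    using t01[of n] t01[of 0] assms(1) monoD[OF t(1), of 0 n] by (intro ennreal_leI mult_left_le_one_le) auto
  finally show "(\<Sum>i<n. ennreal (dist (\<gamma> (t i)) (\<gamma> (t (Suc i))))) \<le> ennreal d" .
qed

lemma curve_length_cong:
  assumes "\<And>s t. \<lbrakk>s \<in> {0..1}; t \<in> {0..1}\<rbrakk> \<Longrightarrow> dist (\<gamma> s) (\<gamma> t) = dist (\<delta> s) (\<delta> t)"
  shows "curve_length \<gamma> = curve_length \<delta>"
  unfolding curve_length_def
proof (intro SUP_cong refl, clarify)
  fix n :: nat and t :: "nat \<Rightarrow> real"
  assume "range t \<subseteq> {0..1}"
  then have "t i \<in> {0..1}" for i by (simp add: image_subset_iff)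
  then show "(\<Sum>i<n. ennreal (dist (\<gamma> (t i)) (\<gamma> (t (Suc i)))))
      = (\<Sum>i<n. ennreal (dist (\<delta> (t i)) (\<delta> (t (Suc i)))))"
    using assms by simp
qed

lemma induced_metric_dist_le:
  assumes "induced_metric Y p" "path \<gamma>" "path_image \<gamma> \<subseteq> Y" "pathstart \<gamma> = x" "pathfinish \<gamma> = y"
  shows "ennreal (dist x y) \<le> curve_length (p \<circ> \<gamma>)"
proof -
  have "x \<in> Y" "y \<in> Y"
    using assms pathstart_in_path_image pathfinish_in_path_image by blast+
  then show ?thesis
    using assms unfolding induced_metric_def by (auto intro!: INF_lower)
qed

text \<open>The distance in \<open>Y\<close> is an infimum of lengths of projected paths, and each
  such length is at least the distance between the projected end points.\<close>

lemma induced_metric_nonexpanding: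
  assumes "induced_metric Y p" "x \<in> Y" "y \<in> Y"
  shows "dist (p x) (p y) \<le> dist x y"
proof -
  have "ennreal (dist (p x) (p y)) \<le> ennreal (dist x y)"
    using assms dist_ends_le_curve_length[of "p \<circ> _"] unfolding induced_metric_def
    by (force intro!: INF_greatest simp: pathstart_def pathfinish_def)
  then show ?thesis by simp
qed

section \<open>Geodesics in CAT(0) spaces\<close>

lemma geodesic_segment_path:
  assumes "geodesic_segment S x y \<gamma>"
  shows "path \<gamma>" "path_image \<gamma> \<subseteq> S" "pathstart \<gamma> = x" "pathfinish \<gamma> = y"
proof -
  have "(dist x y)-lipschitz_on {0..1} \<gamma>"
    using assms by (intro lipschitz_onI) (auto simp: geodesic_segment_def dist_real_def mult.commute)
  then show "path \<gamma>"
    unfolding path_def by (rule lipschitz_on_continuous_on)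
qed (use assms in \<open>auto simp: geodesic_segment_def path_image_def pathstart_def pathfinish_def\<close>)

lemma geodesic_segment_dist_le:
  assumes "geodesic_segment S x y \<gamma>" "t \<in> {0..1}"
  shows "dist x (\<gamma> t) \<le> dist x y"
proof -
  have "dist (\<gamma> 0) (\<gamma> t) = \<bar>0 - t\<bar> * dist x y"
    using assms unfolding geodesic_segment_def by (metis atLeastAtMost_iff order_refl zero_le_one)
  then show ?thesis
    using assms by (simp add: geodesic_segment_def mult_left_le_one_le)
qed

text \<open>A geodesic from the centre of a ball stays inside the ball, so all balls are path
  connected. This is what makes maps defined on \<open>Y\<close> liftable.\<close>

lemma CAT0_imp_locally_path_connected:
  assumes "CAT0 S"
  shows "locally path_connected S"
proof (rule locallyI)
  fix w x assume w: "openin (top_of_set S) w" "x \<in> w"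
  then have x: "x \<in> S"
    using openin_imp_subset by blast
  obtain e where e: "e > 0" "ball x e \<inter> S \<subseteq> w"
    using w unfolding openin_contains_ball by blast
  have comp: "path_component (ball x e \<inter> S) x y" if y: "y \<in> ball x e \<inter> S" for y
  proof -
    obtain \<gamma> where \<gamma>: "geodesic_segment S x y \<gamma>"
      using assms y x unfolding CAT0_def by blast
    have "\<gamma> t \<in> ball x e" if "t \<in> {0..1}" for t
      using geodesic_segment_dist_le[OF \<gamma> that] y by simp
    then show ?thesis
      using geodesic_segment_path[OF \<gamma>] unfolding path_component_def
      by (intro exI[of _ \<gamma>]) (auto simp: path_image_def)
  qed
  then have "path_connected (ball x e \<inter> S)"
    unfolding path_connected_component by (meson path_component_sym path_component_trans)
  then show "\<exists>u v. openin (top_of_set S) u \<and> path_connected v \<and> x \<in> u \<and> u \<subseteq> v \<and> v \<subseteq> w"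
    using e x by (intro exI[of _ "ball x e \<inter> S"]) (auto simp: Int_commute intro!: openin_open_Int)
qed

text \<open>The two geodesics are sides of a degenerate triangle with vertices
  \<open>x, y, y\<close>. Its comparison triangle \<open>0, b, b\<close> has coinciding sides, so
  points with equal parameter have distance 0.\<close>

lemma CAT0_geodesic_unique:
  assumes "CAT0 S" "x \<in> S" "y \<in> S" and \<beta>: "geodesic_segment S x y \<beta>" and \<gamma>: "geodesic_segment S x y \<gamma>"
    and t: "t \<in> {0..1}"
  shows "\<beta> t = \<gamma> t"
proof -
  obtain b :: "real^2" where b: "norm b = dist x y"
    using vector_choose_size zero_le_dist by blast
  have "dist (\<beta> t) (\<gamma> t) \<le> dist (linepath 0 b t) (linepath 0 b t)"
    using assms(1)[unfolded CAT0_def, THEN conjunct2, rule_format, OF assms(2,3,3) conjI[OF \<beta> \<gamma>], of 0 b b t t]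
      b t by simp
  then show ?thesis by simp
qed

text \<open>Applying \<open>L\<close> to a path from \<open>x\<close> to \<open>y\<close> gives a
  path from \<open>L x\<close> to \<open>L y\<close> whose projection is the
  \<open>\<sigma>\<close>-image of the old projection and hence equally long. The infimum over such
  paths gives the bound.\<close>

lemma lift_nonexpanding:
  assumes Y: "induced_metric Y p" "p ` Y \<subseteq> X"
    and \<sigma>: "\<And>x y. \<lbrakk>x \<in> X; y \<in> X\<rbrakk> \<Longrightarrow> dist (\<sigma> x) (\<sigma> y) = dist x y"
    and L: "continuous_on Y L" "L \<in> Y \<rightarrow> Y" "\<And>y. y \<in> Y \<Longrightarrow> p (L y) = \<sigma> (p y)"
    and xy: "x \<in> Y" "y \<in> Y"
  shows "dist (L x) (L y) \<le> dist x y"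
proof -
  have "ennreal (dist (L x) (L y)) \<le> curve_length (p \<circ> \<gamma>)"
    if "path \<gamma>" "path_image \<gamma> \<subseteq> Y" "pathstart \<gamma> = x" "pathfinish \<gamma> = y" for \<gamma>
  proof -
    have \<gamma>Y: "\<gamma> t \<in> Y" if "t \<in> {0..1}" for t
      using \<open>path_image \<gamma> \<subseteq> Y\<close> that by (auto simp: path_image_def)
    have "ennreal (dist (L x) (L y)) \<le> curve_length (p \<circ> (L \<circ> \<gamma>))"
      using that L(1,2) by (intro induced_metric_dist_le[OF Y(1)])
        (auto simp: path_image_compose pathstart_compose pathfinish_compose
          intro: path_continuous_image continuous_on_subset)
    also have "\<dots> = curve_length (p \<circ> \<gamma>)"
      using \<gamma>Y L(3) \<sigma> Y(2) by (intro curve_length_cong) (auto simp: image_subset_iff)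
    finally show ?thesis .
  qed
  then have "ennreal (dist (L x) (L y)) \<le> ennreal (dist x y)"
    using Y(1) xy unfolding induced_metric_def by (auto intro!: INF_greatest)
  then show ?thesis by simp
qed

text \<open>One inequality holds globally because \<open>p\<close> is nonexpanding. For the other,
  nearby points of \<open>X\<close> are joined by a geodesic inside an evenly covered set, and its
  lift bounds the distance upstairs by the distance downstairs.\<close>

lemma covering_local_isometry:
  assumes cov: "covering_space Y p X" and met: "induced_metric Y p" and loc: "locally_CAT0 X"
    and a: "a \<in> Y"
  obtains e where "e > 0" "\<And>x y. \<lbrakk>x \<in> Y \<inter> ball a e; y \<in> Y \<inter> ball a e\<rbrakk> \<Longrightarrow> dist (p x) (p y) = dist x y"
proof -
  obtain T U q where T: "a \<in> T" "openin (top_of_set Y) T" "p a \<in> U" "openin (top_of_set X) U"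
    and hom: "homeomorphism T U p q"
    using covering_space_local_homeomorphism[OF cov a] by metis
  obtain r where r: "r > 0" "CAT0 (X \<inter> ball (p a) r)"
    using loc covering_space_imp_surjective[OF cov] a unfolding locally_CAT0_def by blast
  obtain d1 where d1: "d1 > 0" "ball a d1 \<inter> Y \<subseteq> T"
    using T(1,2) unfolding openin_contains_ball by blast
  obtain d2 where d2: "d2 > 0" "ball (p a) d2 \<inter> X \<subseteq> U"
    using T(3,4) unfolding openin_contains_ball by blast
  \<comment> \<open>\<open>d1\<close> keeps the ball in the sheet \<open>T\<close> and
    \<open>r\<close> keeps its projection in the CAT(0) ball. A geodesic between points within
    \<open>e\<close> of \<open>p a\<close> has length below \<open>2 * e\<close>, so it stays within
    \<open>3 * e\<close> of \<open>p a\<close>, which explains \<open>d2 / 3\<close>.\<close>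
  define e where "e = min d1 (min (r / 3) (d2 / 3))"
  have e: "e > 0" "e \<le> d1" "3 * e \<le> r" "3 * e \<le> d2"
    using d1 d2 r by (auto simp: e_def)
  show ?thesis
  proof (rule that[OF e(1)])
    fix x y assume x: "x \<in> Y \<inter> ball a e" and y: "y \<in> Y \<inter> ball a e"
    have xT: "x \<in> T" and yT: "y \<in> T" using x y d1 e by auto
    have X: "p x \<in> X" "p y \<in> X" using x y cov by (auto simp: covering_space_def)
    have px: "dist (p a) (p x) < e" and py: "dist (p a) (p y) < e"
      using induced_metric_nonexpanding[OF met a, of x] induced_metric_nonexpanding[OF met a, of y] x y
      by auto
    then have "p x \<in> X \<inter> ball (p a) r" "p y \<in> X \<inter> ball (p a) r"
      using X e by auto
    then obtain \<gamma> where \<gamma>: "geodesic_segment (X \<inter> ball (p a) r) (p x) (p y) \<gamma>"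
      using r(2) unfolding CAT0_def by blast
    have "\<gamma> t \<in> U" if "t \<in> {0..1}" for t
    proof -
      have "dist (p x) (\<gamma> t) \<le> dist (p x) (p y)"
        using geodesic_segment_dist_le[OF \<gamma> that] .
      also have "\<dots> < 2 * e"
        using px py dist_triangle3[of "p x" "p y" "p a"] by simp
      finally have "dist (p a) (\<gamma> t) < d2"
        using px e dist_triangle[of "p a" "\<gamma> t" "p x"] by simp
      moreover have "\<gamma> t \<in> X"
        using \<gamma> that by (auto simp: geodesic_segment_def)
      ultimately show ?thesis using d2 by auto
    qed
    then have \<gamma>U: "path_image \<gamma> \<subseteq> U" by (auto simp: path_image_def)
    have q: "continuous_on U q" "q ` U = T" "\<And>u. u \<in> U \<Longrightarrow> p (q u) = u" "q (p x) = x" "q (p y) = y"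
      using hom xT yT by (auto simp: homeomorphism_def)
    have TY: "T \<subseteq> Y" using T(2) openin_imp_subset by blast
    have "ennreal (dist x y) \<le> curve_length (p \<circ> (q \<circ> \<gamma>))"
      using geodesic_segment_path[OF \<gamma>] \<gamma>U q TY
      by (intro induced_metric_dist_le[OF met])
        (auto simp: path_image_compose pathstart_compose pathfinish_compose
          intro: path_continuous_image continuous_on_subset)
    also have "\<dots> = curve_length \<gamma>"
      using \<gamma>U q(3) by (intro curve_length_cong) (auto simp: path_image_def image_subset_iff)
    also have "\<dots> \<le> ennreal (dist (p x) (p y))"
      using \<gamma> by (intro curve_length_le) (auto simp: geodesic_segment_def)
    finally have "dist x y \<le> dist (p x) (p y)" by simp
    then show "dist (p x) (p y) = dist x y"
      using induced_metric_nonexpanding[OF met, of x y] x y by simp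
  qed
qed

text \<open>The images of \<open>x\<close>, \<open>\<gamma> s\<close>, \<open>\<gamma> t\<close>,
  \<open>y\<close> satisfy the triangle inequality with total at least \<open>dist x y\<close>,
  while none of the three pieces got longer; hence none got shorter.\<close>

lemma nonexpanding_geodesic_segment:
  assumes \<gamma>: "geodesic_segment S x y \<gamma>" and "L \<in> S \<rightarrow> S" "L x = x" "L y = y"
    and L: "\<And>a b. \<lbrakk>a \<in> S; b \<in> S\<rbrakk> \<Longrightarrow> dist (L a) (L b) \<le> dist a b"
  shows "geodesic_segment S x y (L \<circ> \<gamma>)"
proof -
  have le: "dist (L (\<gamma> s)) (L (\<gamma> t)) \<le> \<bar>s - t\<bar> * dist x y" if "s \<in> {0..1}" "t \<in> {0..1}" for s t
    using L[of "\<gamma> s" "\<gamma> t"] \<gamma> that by (auto simp: geodesic_segment_def image_subset_iff)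
  have ends: "\<gamma> 0 = x" "\<gamma> 1 = y" using \<gamma> by (auto simp: geodesic_segment_def)
  have eq: "dist (L (\<gamma> s)) (L (\<gamma> t)) = \<bar>s - t\<bar> * dist x y" if "0 \<le> s" "s \<le> t" "t \<le> 1" for s t
  proof -
    have "dist x y \<le> dist (L (\<gamma> 0)) (L (\<gamma> s)) + dist (L (\<gamma> s)) (L (\<gamma> t)) + dist (L (\<gamma> t)) (L (\<gamma> 1))"
      using dist_triangle[of x y "L (\<gamma> s)"] dist_triangle[of "L (\<gamma> s)" y "L (\<gamma> t)"] assms(3,4) ends by simp
    moreover have "dist (L (\<gamma> 0)) (L (\<gamma> s)) \<le> s * dist x y" "dist (L (\<gamma> t)) (L (\<gamma> 1)) \<le> (1 - t) * dist x y"
      using le[of 0 s] le[of t 1] that by auto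
    ultimately have "(t - s) * dist x y \<le> dist (L (\<gamma> s)) (L (\<gamma> t))"
      by (simp add: algebra_simps)
    then show ?thesis
      using le[of s t] that by auto
  qed
  have all: "dist (L (\<gamma> s)) (L (\<gamma> t)) = \<bar>s - t\<bar> * dist x y" if "s \<in> {0..1}" "t \<in> {0..1}" for s t
    using eq[of s t] eq[of t s] that by (cases s t rule: le_cases) (auto simp: dist_commute abs_minus_commute)
  have "\<gamma> ` {0..1} \<subseteq> S" using \<gamma> by (simp add: geodesic_segment_def)
  then have "(L \<circ> \<gamma>) ` {0..1} \<subseteq> S" using assms(2) by auto
  then show ?thesis
    unfolding geodesic_segment_def using ends assms(3,4) by (simp add: all)
qed

text \<open>\<open>link_map\<close> moves every representative of the germ. A representative
  \<delta> agrees with \<gamma> near 0, so \<open>\<sigma> \<circ> \<delta>\<close> agrees there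
  with \<open>\<sigma> \<circ> \<gamma>\<close>, that is, with \<gamma>. All images thus lie in the
  germ of \<gamma>.\<close>

lemma link_map_fixed_germ:
  assumes \<gamma>: "\<gamma> \<in> geodesics_from X v" and \<sigma>: "\<sigma> \<in> X \<rightarrow> X" "\<sigma> v = v"
    "\<And>x y. \<lbrakk>x \<in> X; y \<in> X\<rbrakk> \<Longrightarrow> dist (\<sigma> x) (\<sigma> y) = dist x y"
    and fixed: "e > 0" "\<And>t. t \<in> {0..e} \<Longrightarrow> \<sigma> (\<gamma> t) = \<gamma> t"
  shows "link_map X v \<sigma> (germ_rel X v `` {\<gamma>}) = germ_rel X v `` {\<gamma>}"
proof -
  have germ_trans: "(\<alpha>, \<delta>) \<in> germ_rel X v"
    if ab: "(\<alpha>, \<beta>) \<in> germ_rel X v" and bd: "(\<beta>, \<delta>) \<in> germ_rel X v" for \<alpha> \<beta> \<delta>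
  proof -
    obtain d d' where "d > 0" "\<forall>t\<in>{0..d}. \<alpha> t = \<beta> t" "d' > 0" "\<forall>t\<in>{0..d'}. \<beta> t = \<delta> t"
      using ab bd by (auto simp: germ_rel_def)
    then have "min d d' > 0" "\<forall>t\<in>{0..min d d'}. \<alpha> t = \<delta> t" by auto
    then show ?thesis
      using ab bd unfolding germ_rel_def by blast
  qed
  have germ_sym: "(\<beta>, \<alpha>) \<in> germ_rel X v" if "(\<alpha>, \<beta>) \<in> germ_rel X v" for \<alpha> \<beta>
    using that by (auto simp: germ_rel_def)
  have \<sigma>g: "\<sigma> \<circ> \<delta> \<in> geodesics_from X v" if "\<delta> \<in> geodesics_from X v" for \<delta>
  proof -
    obtain d where d: "\<delta> 0 = v" "d > 0" "\<And>t. t \<in> {0..d} \<Longrightarrow> \<delta> t \<in> X"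
      "\<And>s t. \<lbrakk>s \<in> {0..d}; t \<in> {0..d}\<rbrakk> \<Longrightarrow> dist (\<delta> s) (\<delta> t) = \<bar>s - t\<bar>"
      using \<open>\<delta> \<in> geodesics_from X v\<close> unfolding geodesics_from_def by (auto simp: image_subset_iff)
    then show ?thesis
      using \<sigma> unfolding geodesics_from_def by (auto simp: image_subset_iff Pi_iff intro!: exI[of _ d])
  qed
  have \<gamma>\<delta>: "(\<gamma>, \<sigma> \<circ> \<delta>) \<in> germ_rel X v" if \<delta>: "(\<gamma>, \<delta>) \<in> germ_rel X v" for \<delta>
  proof -
    obtain d where d: "d > 0" "\<forall>t\<in>{0..d}. \<gamma> t = \<delta> t"
      using \<delta> by (auto simp: germ_rel_def)
    have "\<gamma> t = (\<sigma> \<circ> \<delta>) t" if "t \<in> {0..min d e}" for t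
      using d(2) fixed(2)[of t] that by (metis atLeastAtMost_iff comp_apply min.boundedE)
    then have "min d e > 0" "\<forall>t\<in>{0..min d e}. \<gamma> t = (\<sigma> \<circ> \<delta>) t"
      using d(1) fixed(1) by auto
    then show ?thesis
      using \<delta> \<sigma>g unfolding germ_rel_def by blast
  qed
  have refl: "(\<gamma>, \<gamma>) \<in> germ_rel X v"
    using \<gamma> by (auto simp: germ_rel_def intro: exI[of _ 1])
  show ?thesis
    unfolding link_map_def using \<gamma>\<delta> germ_sym germ_trans refl by blast
qed

lemma fixed_loop_trivial:
  fixes X :: "'a::metric_space set" and Y :: "'b::metric_space set"
  assumes cover: "universal_cover Y p X" and npc: "nonpositively_curved X Y p"
    and \<sigma>: "\<sigma> \<in> X \<rightarrow> X" "\<sigma> v = v"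
      "\<And>x y. \<lbrakk>x \<in> X; y \<in> X\<rbrakk> \<Longrightarrow> dist (\<sigma> x) (\<sigma> y) = dist x y"
    and link: "\<And>\<xi>. \<xi> \<in> link X v \<Longrightarrow> link_map X v \<sigma> \<xi> \<noteq> \<xi>"
    and g: "loop_at X v g" and hom: "homotopic_paths X (\<sigma> \<circ> g) g"
  shows "homotopic_paths X g (\<lambda>_. v)"
proof -
  have cov: "covering_space Y p X" and sc: "simply_connected Y"
    using cover by (auto simp: universal_cover_def)
  have loc: "locally_CAT0 X" and met: "induced_metric Y p" and cat: "CAT0 Y"
    using npc by (auto simp: nonpositively_curved_def)
  have pY: "p ` Y = X" and cp: "continuous_on Y p"
    using cov by (auto simp: covering_space_def)
  have "v \<in> X" using g by (metis loop_at_def pathstart_in_path_image subsetD)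
  then obtain a where a: "a \<in> Y" "p a = v" using pY by auto
  have "1-lipschitz_on X \<sigma>"
    using \<sigma>(3) by (intro lipschitz_onI) auto
  then have c\<sigma>: "continuous_on X \<sigma>" by (rule lipschitz_on_continuous_on)
  have "continuous_on Y (\<sigma> \<circ> p)"
    using cp c\<sigma> pY by (intro continuous_on_compose) auto
  moreover have "\<sigma> \<circ> p \<in> Y \<rightarrow> X"
    using \<sigma>(1) pY by (simp add: Pi_iff image_iff) blast
  moreover have "(\<sigma> \<circ> p) a = p a"
    using a \<sigma>(2) by simp
  ultimately obtain L
    where L: "continuous_on Y L" "L \<in> Y \<rightarrow> Y" "L a = a" "\<And>y. y \<in> Y \<Longrightarrow> p (L y) = (\<sigma> \<circ> p) y"
    using metric_covering_space_lift[OF cov a(1) a(1) sc CAT0_imp_locally_path_connected[OF cat]]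
    by blast
  obtain h where h: "path h" "path_image h \<subseteq> Y" "pathstart h = a" "\<And>t. t \<in> {0..1} \<Longrightarrow> p (h t) = g t"
    using metric_covering_space_lift_path[OF cov a(1), of g] g a(2) by (auto simp: loop_at_def)
  define w where "w = pathfinish h"
  have w: "w \<in> Y" using h by (auto simp: w_def pathfinish_in_path_image)
  \<comment> \<open>\<open>L \<circ> h\<close> and \<open>h\<close> are lifts starting at
    \<open>a\<close> of the homotopic loops \<open>\<sigma> \<circ> g\<close> and
    \<open>g\<close>.\<close>
  have "pathfinish (L \<circ> h) = pathfinish h"
  proof (rule metric_covering_space_monodromy[OF cov hom])
    show "path (L \<circ> h)" "path_image (L \<circ> h) \<subseteq> Y" "pathstart (L \<circ> h) = pathstart h"
      using h L by (auto simp: path_image_compose pathstart_compose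
          intro: path_continuous_image continuous_on_subset)
    show "p ((L \<circ> h) t) = (\<sigma> \<circ> g) t" if "t \<in> {0..1}" for t
      using L(4)[of "h t"] h that by (auto simp: path_image_def image_subset_iff)
  qed (use h in auto)
  then have Lw: "L w = w" by (simp add: w_def pathfinish_compose)
  have "w = a"
  proof (rule ccontr)
    assume "w \<noteq> a"
    define d where "d = dist a w"
    have d: "d > 0" using \<open>w \<noteq> a\<close> by (simp add: d_def)
    obtain \<gamma> where \<gamma>: "geodesic_segment Y a w \<gamma>"
      using cat a(1) w unfolding CAT0_def by blast
    have L\<gamma>_geodesic: "geodesic_segment Y a w (L \<circ> \<gamma>)"
    proof (rule nonexpanding_geodesic_segment[OF \<gamma> L(2,3) Lw])
      show "dist (L x) (L y) \<le> dist x y" if "x \<in> Y" "y \<in> Y" for x y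
        using lift_nonexpanding[OF met eq_refl[OF pY] \<sigma>(3) L(1,2) _ that] L(4) by simp
    qed
    have L\<gamma>: "L (\<gamma> t) = \<gamma> t" if "t \<in> {0..1}" for t
      using CAT0_geodesic_unique[OF cat a(1) w L\<gamma>_geodesic \<gamma> that] by simp
    obtain e where e: "e > 0"
      "\<And>x y. \<lbrakk>x \<in> Y \<inter> ball a e; y \<in> Y \<inter> ball a e\<rbrakk> \<Longrightarrow> dist (p x) (p y) = dist x y"
      using covering_local_isometry[OF cov met loc a(1)] by metis
    \<comment> \<open>At most \<open>d\<close>, so that \<open>t / d\<close> is a parameter of
      \<gamma>, and strictly below \<open>e\<close>, so that the initial piece lies in the open ball
      where \<open>p\<close> preserves distances.\<close>
    define \<epsilon> where "\<epsilon> = min (e / 2) d"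
    have \<epsilon>: "\<epsilon> > 0" "\<epsilon> \<le> d" "\<epsilon> < e" using e d by (auto simp: \<epsilon>_def)
    \<comment> \<open>\<gamma> has speed \<open>d\<close> on \<open>{0..1}\<close>, whereas elements
      of \<open>geodesics_from\<close> have unit speed; dividing by \<open>d\<close> passes to arc
      length.\<close>
    define c where "c t = p (\<gamma> (t / d))" for t
    have \<gamma>d: "dist (\<gamma> (s / d)) (\<gamma> (t / d)) = \<bar>s - t\<bar>" if "s \<in> {0..d}" "t \<in> {0..d}" for s t
    proof -
      have "dist (\<gamma> (s / d)) (\<gamma> (t / d)) = \<bar>s / d - t / d\<bar> * d"
        using \<gamma> that d by (auto simp: geodesic_segment_def d_def)
      also have "\<dots> = \<bar>s - t\<bar>"
        using d by (simp add: abs_mult flip: diff_divide_distrib)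
      finally show ?thesis .
    qed
    have \<gamma>0: "\<gamma> 0 = a" using \<gamma> by (simp add: geodesic_segment_def)
    have \<gamma>Y: "\<gamma> (t / d) \<in> Y" if "t \<in> {0..\<epsilon>}" for t
      using \<gamma> that \<epsilon> d by (auto simp: geodesic_segment_def image_subset_iff)
    have \<gamma>b: "\<gamma> (t / d) \<in> Y \<inter> ball a e" if "t \<in> {0..\<epsilon>}" for t
      using \<gamma>Y[OF that] \<gamma>d[of 0 t] that \<epsilon> d \<gamma>0 by simp
    have "dist (c s) (c t) = \<bar>s - t\<bar>" if "s \<in> {0..\<epsilon>}" "t \<in> {0..\<epsilon>}" for s t
      using e(2)[OF \<gamma>b \<gamma>b] \<gamma>d[of s t] that \<epsilon> by (simp add: c_def)
    moreover have "c 0 = v" using a \<gamma>0 by (simp add: c_def)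
    moreover have "c ` {0..\<epsilon>} \<subseteq> X" using \<gamma>Y pY by (auto simp: c_def)
    ultimately have cg: "c \<in> geodesics_from X v"
      using \<epsilon>(1) by (auto simp: geodesics_from_def)
    have "\<sigma> (c t) = c t" if "t \<in> {0..\<epsilon>}" for t
      using L\<gamma>[of "t / d"] L(4)[OF \<gamma>Y[OF that]] that \<epsilon> d by (simp add: c_def)
    then have "link_map X v \<sigma> (germ_rel X v `` {c}) = germ_rel X v `` {c}"
      using link_map_fixed_germ[OF cg \<sigma> \<epsilon>(1)] by blast
    moreover have "germ_rel X v `` {c} \<in> link X v"
      using cg by (simp add: link_def quotientI)
    ultimately show False using link by blast
  qed
  \<comment> \<open>The lift is now a loop; it contracts in the simply connected \<open>Y\<close>,
    and the contraction projects to one of \<open>g\<close>.\<close>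
  then have "homotopic_paths Y h (\<lambda>_. a)"
    using simply_connected_imp_homotopic_const[OF sc h(1-3)] by (simp add: w_def)
  then have "homotopic_paths X (p \<circ> h) (p \<circ> (\<lambda>_. a))"
    using cp pY by (intro homotopic_paths_continuous_image) auto
  moreover have "homotopic_paths X g (p \<circ> h)"
    using g h(4) by (intro homotopic_paths_eq) (auto simp: loop_at_def)
  ultimately show ?thesis
    using a(2) homotopic_paths_trans by (fastforce simp: comp_def)
qed

section \<open>Groups of isometries acting on the fundamental group\<close>

lemma subgroup_isometries:
  "subgroup {g \<in> Bij X. \<forall>x\<in>X. \<forall>y\<in>X. dist (g x) (g y) = dist x y} (BijGroup X)"
proof -
  interpret B: group "BijGroup X" by (rule group_BijGroup)
  show ?thesis
  proof (rule B.subgroupI)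
    show "{g \<in> Bij X. \<forall>x\<in>X. \<forall>y\<in>X. dist (g x) (g y) = dist x y} \<noteq> {}"
      using id_Bij[of X] by (auto intro!: exI[of _ "\<lambda>x\<in>X. x"])
  next
    fix g assume g: "g \<in> {g \<in> Bij X. \<forall>x\<in>X. \<forall>y\<in>X. dist (g x) (g y) = dist x y}"
    then have inv: "inv_into X g x \<in> X" "g (inv_into X g x) = x" if "x \<in> X" for x
      using that by (auto simp: Bij_def bij_betw_def inv_into_into f_inv_into_f)
    have "dist (inv_into X g x) (inv_into X g y) = dist x y" if "x \<in> X" "y \<in> X" for x y
    proof -
      have "dist (g (inv_into X g x)) (g (inv_into X g y)) = dist (inv_into X g x) (inv_into X g y)"
        using g inv(1)[OF that(1)] inv(1)[OF that(2)] by blast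
      then show ?thesis
        by (simp add: inv(2) that)
    qed
    then show "inv\<^bsub>BijGroup X\<^esub> g \<in> {g \<in> Bij X. \<forall>x\<in>X. \<forall>y\<in>X. dist (g x) (g y) = dist x y}"
      using g by (simp add: inv_BijGroup restrict_inv_into_Bij)
  next
    fix g h
    assume "g \<in> {g \<in> Bij X. \<forall>x\<in>X. \<forall>y\<in>X. dist (g x) (g y) = dist x y}"
      "h \<in> {g \<in> Bij X. \<forall>x\<in>X. \<forall>y\<in>X. dist (g x) (g y) = dist x y}"
    moreover from this have "h x \<in> X" if "x \<in> X" for x
      using that Bij_imp_funcset by blast
    ultimately show "g \<otimes>\<^bsub>BijGroup X\<^esub> h \<in> {g \<in> Bij X. \<forall>x\<in>X. \<forall>y\<in>X. dist (g x) (g y) = dist x y}"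
      by (simp add: BijGroup_def compose_Bij compose_eq)
  qed (auto simp: BijGroup_def)
qed

lemma group_isometry_group: "group (isometry_group X)"
  unfolding isometry_group_def
  by (rule group.subgroup_imp_group[OF group_BijGroup subgroup_isometries])

lemma isometry_groupD:
  assumes "g \<in> carrier (isometry_group X)"
  shows "g \<in> X \<rightarrow> X" "\<And>x y. \<lbrakk>x \<in> X; y \<in> X\<rbrakk> \<Longrightarrow> dist (g x) (g y) = dist x y" "continuous_on X g"
proof -
  show "g \<in> X \<rightarrow> X"
    using assms by (simp add: isometry_group_def Bij_imp_funcset)
  show d: "dist (g x) (g y) = dist x y" if "x \<in> X" "y \<in> X" for x y
    using assms that by (simp add: isometry_group_def)
  have "1-lipschitz_on X g"
    using d by (intro lipschitz_onI) auto
  then show "continuous_on X g" by (rule lipschitz_on_continuous_on)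
qed

lemma mult_isometry_group:
  assumes "g \<in> carrier (isometry_group X)" "h \<in> carrier (isometry_group X)" "x \<in> X"
  shows "(g \<otimes>\<^bsub>isometry_group X\<^esub> h) x = g (h x)"
  using assms by (simp add: isometry_group_def BijGroup_def compose_def)

lemma one_isometry_group: "x \<in> X \<Longrightarrow> \<one>\<^bsub>isometry_group X\<^esub> x = x"
  by (simp add: isometry_group_def BijGroup_def)

text \<open>The conditions on \<sigma> define a subgroup, so they pass from the generator to the
  whole cyclic group.\<close>

lemma subgroup_fixing_invariant:
  assumes v: "v \<in> X"
  shows "subgroup {g \<in> carrier (isometry_group X). g v = v \<and> (\<forall>x\<in>X. f (g x) = f x)} (isometry_group X)"
    (is "subgroup ?S ?I")
proof -
  interpret I: group ?I by (rule group_isometry_group)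
  show ?thesis
  proof (rule I.subgroupI)
    show "?S \<noteq> {}"
      using v I.one_closed by (auto simp: one_isometry_group intro!: exI[of _ "\<one>\<^bsub>?I\<^esub>"])
  next
    fix g assume g: "g \<in> ?S"
    then have gI: "g \<in> carrier ?I" by simp
    have inv: "(inv\<^bsub>?I\<^esub> g) (g x) = x" "g ((inv\<^bsub>?I\<^esub> g) x) = x" if "x \<in> X" for x
      using that gI mult_isometry_group[of "inv\<^bsub>?I\<^esub> g" X g x] mult_isometry_group[of g X "inv\<^bsub>?I\<^esub> g" x]
      by (simp_all add: one_isometry_group)
    have "f ((inv\<^bsub>?I\<^esub> g) x) = f x" if "x \<in> X" for x
      using g inv(2)[OF that] isometry_groupD(1)[OF I.inv_closed[OF gI]] that
      by (metis (mono_tags, lifting) PiE mem_Collect_eq)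
    moreover have "(inv\<^bsub>?I\<^esub> g) v = v"
      using g inv(1)[OF v] by simp
    ultimately show "inv\<^bsub>?I\<^esub> g \<in> ?S"
      using gI by simp
  next
    fix g h assume gh: "g \<in> ?S" "h \<in> ?S"
    then show "g \<otimes>\<^bsub>?I\<^esub> h \<in> ?S"
      using v isometry_groupD(1)[of h X] by (auto simp: mult_isometry_group Pi_iff)
  qed auto
qed

text \<open>Isometries fixing \<open>v\<close> send loops at \<open>v\<close> to loops at
  \<open>v\<close>, and functoriality of \<open>induced_map\<close> gives the action laws.\<close>

lemma semidirect_fundamental_group:
  fixes X :: "'a::metric_space set"
  assumes v: "v \<in> X" and H: "subgroup H (isometry_group X)" and stab: "\<And>h. h \<in> H \<Longrightarrow> h v = v"
  shows "semidirect (fundamental_group X v) ((isometry_group X)\<lparr>carrier := H\<rparr>) (induced_map X)"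
proof -
  note iso = isometry_groupD[OF subgroup.mem_carrier[OF H]]
  interpret H: group "(isometry_group X)\<lparr>carrier := H\<rparr>"
    by (rule group.subgroup_imp_group[OF group_isometry_group H])
  interpret G: group "fundamental_group X v"
    by (rule group_fundamental_group[OF v])
  show ?thesis
  proof
    fix h assume "h \<in> carrier ((isometry_group X)\<lparr>carrier := H\<rparr>)"
    then have h: "h \<in> H" by simp
    show "induced_map X h \<in> hom (fundamental_group X v) (fundamental_group X v)"
      using induced_map_hom[OF iso(3)[OF h] iso(1)[OF h], of v] stab[OF h] by simp
    fix k a assume "k \<in> carrier ((isometry_group X)\<lparr>carrier := H\<rparr>)"
      and a: "a \<in> carrier (fundamental_group X v)"
    then have k: "k \<in> H" by simp
    have "induced_map X (h \<otimes>\<^bsub>isometry_group X\<^esub> k) a = induced_map X h (induced_map X k a)"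
      using iso(3)[OF k] iso(1)[OF k] iso(3)[OF h] iso(1)[OF h] _ a
      by (rule induced_map_compose) (simp add: mult_isometry_group subgroup.mem_carrier[OF H] h k)
    then show "induced_map X (h \<otimes>\<^bsub>(isometry_group X)\<lparr>carrier := H\<rparr>\<^esub> k) a = induced_map X h (induced_map X k a)"
      by simp
  next
    fix a assume "a \<in> carrier (fundamental_group X v)"
    then show "induced_map X \<one>\<^bsub>(isometry_group X)\<lparr>carrier := H\<rparr>\<^esub> a = a"
      by (intro induced_map_ident) (simp_all add: one_isometry_group)
  qed
qed

section \<open>Conjugacy classes in the extension of the kernel by the isometry\<close>

theorem proposition1p1:
  fixes X :: "'a::metric_space set"
    and \<C> :: "('v::real_normed_vector set \<times> ('v \<Rightarrow> 'a)) set"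
    and Y :: "'b::metric_space set"
    and p :: "'b \<Rightarrow> 'a"
    and f :: "'a \<Rightarrow> complex"
    and \<sigma> :: "'a \<Rightarrow> 'a"
    and v :: 'a
  defines "G \<equiv> fundamental_group X v"
    and "f_star \<equiv> induced_map circle f"
    and "act \<equiv> induced_map X"
  defines "K \<equiv> kernel G (fundamental_group circle (f v)) f_star"
    and "C \<equiv> cyclic_subgroup (isometry_group X) \<sigma>"
  defines "G\<sigma> \<equiv> semidirect_product G C act"
    and "K\<sigma> \<equiv> semidirect_product (G\<lparr>carrier := K\<rparr>) C act"
  assumes "connected X"
    and "affine_cell_complex X \<C>"
    and "universal_cover Y p X"
    and "nonpositively_curved X Y p"
    and "circle_valued_morse_function X \<C> Y p f"
    and "f_star \<in> epi G (fundamental_group circle (f v))"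
    and "\<sigma> \<in> carrier (isometry_group X)"
    and "group.ord (isometry_group X) \<sigma> > 0"
    and "v \<in> zero_skeleton \<C>" and "\<sigma> v = v"
    and "\<forall>\<xi>\<in>link X v. link_map X v \<sigma> \<xi> \<noteq> \<xi>"
    and "\<forall>x\<in>X. f (\<sigma> x) = f x"
  shows "act \<sigma> \<in> iso G G \<and> act \<sigma> ` K = K
    \<and> group G\<sigma> \<and> subgroup (carrier K\<sigma>) G\<sigma>
    \<and> infinite {conjugacy_class K\<sigma> x | x.
         x \<in> carrier K\<sigma> \<and> group.ord K\<sigma> x = group.ord (isometry_group X) \<sigma>}
    \<and> infinite {conjugacy_class K\<sigma> x | x.
         x \<in> conjugacy_class G\<sigma> (\<one>\<^bsub>G\<^esub>, \<sigma>) \<inter> carrier K\<sigma>}"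
proof -
  note cover = \<open>universal_cover Y p X\<close> and npc = \<open>nonpositively_curved X Y p\<close>
    and \<sigma> = \<open>\<sigma> \<in> carrier (isometry_group X)\<close> and \<sigma>v = \<open>\<sigma> v = v\<close>
    and epi = \<open>f_star \<in> epi G (fundamental_group circle (f v))\<close>
  let ?I = "isometry_group X" and ?Q = "fundamental_group circle (f v)"
  interpret I: group ?I by (rule group_isometry_group)
  have v: "v \<in> X"
    using \<open>v \<in> zero_skeleton \<C>\<close> \<open>affine_cell_complex X \<C>\<close>
    unfolding zero_skeleton_def affine_cell_complex_def by fastforce
  have f: "continuous_on X f" "f \<in> X \<rightarrow> circle"
    using \<open>circle_valued_morse_function X \<C> Y p f\<close> by (auto simp: circle_valued_morse_function_def)
  define H where "H = generate ?I {\<sigma>}"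
  have C: "C = ?I\<lparr>carrier := H\<rparr>" by (simp add: C_def cyclic_subgroup_def H_def)
  have H: "subgroup H ?I"
    unfolding H_def using \<sigma> by (intro I.generate_is_subgroup) simp
  have \<sigma>H: "\<sigma> \<in> H" by (simp add: H_def generate.incl)
  have "H \<subseteq> {g \<in> carrier ?I. g v = v \<and> (\<forall>x\<in>X. f (g x) = f x)}"
    unfolding H_def using \<sigma> \<sigma>v \<open>\<forall>x\<in>X. f (\<sigma> x) = f x\<close>
    by (intro I.generate_subgroup_incl subgroup_fixing_invariant v) auto
  then have HD: "h \<in> carrier ?I" "h v = v" "\<And>x. x \<in> X \<Longrightarrow> f (h x) = f x" if "h \<in> H" for h
    using that by auto
  interpret S: semidirect G C act
    unfolding G_def C act_def by (rule semidirect_fundamental_group) (use v H HD(2) in auto)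
  interpret Q: group ?Q
    using f v by (intro group_fundamental_group) auto
  interpret f: group_hom G ?Q f_star
    using epi by unfold_locales (simp add: epi_def)
  have equivariant: "f_star (act h x) = f_star x" if "h \<in> carrier C" "x \<in> carrier G" for h x
  proof -
    have h: "h \<in> H" using that(1) by (simp add: C)
    \<comment> \<open>Functoriality applied to the invariance of \<open>f\<close> under
      \<open>h\<close> on \<open>X\<close>.\<close>
    have "induced_map circle f x = induced_map circle f (induced_map X h x)"
      using isometry_groupD(3,1)[OF HD(1)[OF h]] f _ that(2)[unfolded G_def]
      by (rule induced_map_compose) (simp add: HD(3)[OF h])
    then show ?thesis by (simp add: f_star_def act_def)
  qed
  have \<sigma>C: "\<sigma> \<in> carrier C" using \<sigma>H by (simp add: C)
  have fixed: "x = \<one>\<^bsub>G\<^esub>" if x: "x \<in> carrier G" "act \<sigma> x = x" for x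
  proof -
    obtain g where g: "loop_at X v g" "x = path_class X g"
      using x(1) by (auto simp: G_def carrier_fundamental_group)
    note iso = isometry_groupD[OF \<sigma>]
    have "path_class X (\<sigma> \<circ> g) = path_class X g"
      using x(2) g induced_map_loop_class[OF g(1) iso(3,1)] by (simp add: act_def)
    then have "homotopic_paths X (\<sigma> \<circ> g) g"
      using loop_class_eq_iff[OF loop_at_compose[OF g(1) iso(3,1)]] by blast
    then have "homotopic_paths X g (\<lambda>_. v)"
      using fixed_loop_trivial[OF cover npc iso(1) \<sigma>v iso(2) _ g(1)]
        \<open>\<forall>\<xi>\<in>link X v. link_map X v \<sigma> \<xi> \<noteq> \<xi>\<close> by blast
    then show ?thesis
      using g(2) path_class_cong by (simp add: G_def one_fundamental_group)
  qed
  have comm: "h \<otimes>\<^bsub>C\<^esub> \<sigma> = \<sigma> \<otimes>\<^bsub>C\<^esub> h" if h: "h \<in> carrier C" for h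
  proof -
    \<comment> \<open>All elements of the cyclic group are powers of \<sigma>, which commute with
      \<sigma>.\<close>
    obtain k :: int where "h = \<sigma> [^]\<^bsub>?I\<^esub> k"
      using h I.generate_pow[OF \<sigma>] by (auto simp: C H_def)
    then have "h \<otimes>\<^bsub>?I\<^esub> \<sigma> = \<sigma> \<otimes>\<^bsub>?I\<^esub> h"
      using \<sigma> by (metis I.int_pow_1 I.int_pow_mult add.commute)
    then show ?thesis by (simp add: C)
  qed
  \<comment> \<open>Restricting a carrier leaves the multiplication unchanged, so the semidirect
    product with \<open>K\<close> is the full one with a smaller carrier, and the subgroup lemmas
    apply.\<close>
  have K\<sigma>: "K\<sigma> = S.P\<lparr>carrier := K \<times> carrier C\<rparr>"
    by (simp add: K\<sigma>_def semidirect_product_def)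
  have actK: "act h x \<in> K" if "h \<in> carrier C" "x \<in> K" for h x
    using that equivariant by (simp add: K_def kernel_def)
  have sub: "subgroup (K \<times> carrier C) S.P"
    using actK unfolding K_def by (intro S.subgroup_times f.subgroup_kernel) auto
  have "act \<sigma> ` K = K"
  proof (intro equalityI subsetI)
    fix x assume x: "x \<in> K"
    \<comment> \<open>The preimage of \<open>x\<close> comes from the inverse of \<sigma>, which
      also preserves \<open>K\<close>.\<close>
    then have "x = act \<sigma> (act (inv\<^bsub>C\<^esub> \<sigma>) x)"
      using \<sigma>C by (simp add: S.act_inverse K_def kernel_def)
    then show "x \<in> act \<sigma> ` K"
      using actK[OF _ x, of "inv\<^bsub>C\<^esub> \<sigma>"] \<sigma>C by (intro image_eqI[where f = "act \<sigma>"]) auto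
  qed (use actK \<sigma>C in auto)
  moreover have inf: "infinite {conjugacy_class K\<sigma> x | x.
      x \<in> conjugacy_class G\<sigma> (\<one>\<^bsub>G\<^esub>, \<sigma>) \<inter> carrier K\<sigma>}"
  proof -
    have "infinite (carrier ?Q)"
      using f v by (intro infinite_fundamental_group_circle) auto
    then have "infinite {conjugacy_class (S.P\<lparr>carrier := K \<times> carrier C\<rparr>) x | x.
        x \<in> conjugacy_class S.P (\<one>\<^bsub>G\<^esub>, \<sigma>) \<inter> K \<times> carrier C}"
      unfolding K_def using Q.group_axioms epi equivariant \<sigma>C comm fixed
      by (intro S.infinite_conjugacy_classes) auto
    then show ?thesis
      by (simp add: K\<sigma> G\<sigma>_def)
  qed
  moreover have "infinite {conjugacy_class K\<sigma> x | x.
      x \<in> carrier K\<sigma> \<and> group.ord K\<sigma> x = group.ord ?I \<sigma>}"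
  \<comment> \<open>Conjugates of \<sigma> have the order of \<sigma>, and passing to the subgroup
    preserves orders; hence the classes already found are among those counted here.\<close>
  proof (rule infinite_super[OF _ inf], safe)
    fix x assume x: "x \<in> conjugacy_class G\<sigma> (\<one>\<^bsub>G\<^esub>, \<sigma>)" "x \<in> carrier K\<sigma>"
    then have "group.ord K\<sigma> x = group.ord S.P x"
      using group.ord_subgroup[OF S.group_P sub] by (simp add: K\<sigma>)
    also have "\<dots> = S.H.ord \<sigma>"
      using S.ord_conjugacy_class_P[OF \<sigma>C] x(1) by (simp add: G\<sigma>_def)
    also have "\<dots> = I.ord \<sigma>"
      using I.ord_subgroup[OF H \<sigma>H] by (simp add: C)
    finally show "\<exists>y. conjugacy_class K\<sigma> x = conjugacy_class K\<sigma> y \<and> y \<in> carrier K\<sigma> \<and>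
        group.ord K\<sigma> y = I.ord \<sigma>"
      using x(2) by blast
  qed
  ultimately show ?thesis
    using S.act_iso[OF \<sigma>C] S.group_P sub by (simp add: K\<sigma> G\<sigma>_def)
qed

end
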